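(* Let $\mathcal{E}$ be a system of evolution equations $u_t=f(x,t,u,u_1,\dots,u_k)$, let a Hamiltonian operator $A\colon\hat\varkappa\to\varkappa$ and a recursion operator $R\colon\varkappa\to\varkappa$ define a Poisson--Nijenhuis structure on $\mathcal{E}$, and let $\mathcal{H}_A$ and $\mathcal{N}_R$ be the corresponding shadows in the $\ell^*$-covering and the $\ell$-covering over $\mathcal{E}$, respectively. Then (i) $\{\mathcal{H}_A,\mathcal{H}_A\}=0$; (ii) $\{\mathcal{N}_R,\mathcal{N}_R\}=0$; (iii) $\{\mathcal{H}_A,\mathcal{N}_R\}=0$.
   Context: Setting: $u=(u^1,\dots,u^m)$, one space variable $x$. $\mathcal{E}$ is identified with $J^\infty(\pi)\times\mathbb{R}$ ($\pi$ a rank $m$ vector bundle over the $x$-line), with coordinates $x,t,u^j_k$ and total derivatives $D_x=\partial_x+\sum_{j,k}u^j_{k+1}\partial_{u^j_k}$, $D_t=\partial_t+\sum_{j,k}D_x^k(f^j)\partial_{u^j_k}$; $\mathcal{F}(\mathcal{E})$ is the algebra of smooth functions in $x,t$ and finitely many $u^j_k$. $\varkappa$ and $\hat\varkappa=\mathrm{Hom}_{\mathcal{F}(\mathcal{E})}(\varkappa,\mathcal{F}(\mathcal{E})dx)$ are, in coordinates, modules of $m$-tuples of functions; $\langle\cdot,\cdot\rangle$ is their pairing with values in $\mathcal{F}(\mathcal{E})dx/D_x(\mathcal{F}(\mathcal{E}))dx$, and $\mathbf{E}$ is the Euler operator from this quotient to $\hat\varkappa$. $\mathcal{C}$-differential operators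 are matrices with entries $\sum_i a_iD_x^i$, $a_i\in\mathcal{F}(\mathcal{E})$; $*$ is the formal adjoint. $\mathcal{E}_\varphi=\sum_{j,k}D_x^k(\varphi^j)\partial_{u^j_k}$; $\{\varphi,\psi\}=\mathcal{E}_\varphi(\psi)-\mathcal{E}_\psi(\varphi)$ on $\varkappa$; $\ell_\psi(\varphi)=\mathcal{E}_\varphi(\psi)$; $\ell_{\Delta,\psi}(\varphi)=\mathcal{E}_\varphi(\Delta)(\psi)$ ($\mathcal{E}_\varphi$ acting on coefficients), with adjoint $\ell^*_{\Delta,\psi}$ in $\varphi$; $L_\varphi=\mathcal{E}_\varphi+\ell_\varphi^*$ on $\hat\varkappa$. With $F=u_t-f$: $\ell_{\mathcal{E}}=\ell_F=D_t-\ell_f$, $\ell_F^*=-D_t-\ell_f^*$. $A$ is Hamiltonian if $A^*=-A$ and $[\![A,A]\!]=0$, where $[\![A,B]\!](\psi_1,\psi_2)=-\ell_{A,\psi_1}(B\psi_2)+\ell_{A,\psi_2}(B\psi_1)-A(\ell^*_{B,\psi_1}(\psi_2))-\ell_{B,\psi_1}(A\psi_2)+\ell_{B,\psi_2}(A\psi_1)-B(\ell^*_{A,\psi_1}(\psi_2))$. $R$ is Nijenhuis if $[R,R]_{FN}=0$, where $[R,S]_{FN}(\varphi_1,\varphi_2)=\{R\varphi_1,S\varphi_2\}+\{S\varphi_1,R\varphi_2\}-R(\{S\varphi_1,\varphi_2\}+\{\varphi_1,S\varphi_2\}-S\{\varphi_1,\varphi_2\})-S(\{R\varphi_1,\varphi_2\}+\{\varphi_1,R\varphi_2\}-R\{\varphi_1,\varphi_2\})$.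 $(A,R)$ is a Poisson--Nijenhuis structure on $\mathcal{E}$ if: $A$ is a Hamiltonian $\mathcal{C}$-differential operator, $R$ is a Nijenhuis $\mathcal{C}$-differential operator, $R\circ A=A\circ R^*$; for all $\psi_1,\psi_2\in\hat\varkappa$ $$L_{A\psi_1}(R^*\psi_2)-L_{A\psi_2}(R^*\psi_1)+R^*L_{A\psi_2}(\psi_1)-R^*L_{A\psi_1}(\psi_2)+\mathbf{E}\langle\psi_1,AR^*\psi_2\rangle-R^*\mathbf{E}\langle\psi_1,A\psi_2\rangle=0;$$ and both operators are invariant, i.e. $\ell_F\circ A+A\circ\ell_F^*=0$ and $\ell_F\circ R-R\circ\ell_F=0$ (the latter says $R$ is a recursion operator). Given $RA=AR^*$, the left-hand side of the displayed condition equals $-\ell_{R^*,\psi_1}(A\psi_2)+\ell_{R^*,\psi_2}(A\psi_1)+\ell^*_{A,\psi_1}(R^*\psi_2)+\ell^*_{R^*,\psi_1}(A\psi_2)-R^*(\ell^*_{A,\psi_1}(\psi_2))$. Coverings: on $\mathcal{L}\mathcal{E}\times_{\mathcal{E}}\mathcal{L}^*\mathcal{E}$ there are, besides the coordinates on $\mathcal{E}$, odd (mutually anticommuting) variables $q^j_k,p^j_k$ ($q^j=q^j_0$, $p^j=p^j_0$) subject to $q_t=\ell_f(q)$, $p_t=-\ell_f^*(p)$, with $\tilde D_x=D_x+\sum(q^j_{k+1}\partial_{q^j_k}+p^j_{k+1}\partial_{p^j_k})$ and $\tilde D_t=D_t+\sum(\tilde D_x^k(\tilde\ell_f(q)^j)\partial_{q^j_k}-\tilde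 D_x^k(\tilde\ell_f^*(p)^j)\partial_{p^j_k})$. The $\ell$-covering $\mathcal{L}\mathcal{E}$ (resp. $\ell^*$-covering $\mathcal{L}^*\mathcal{E}$) uses only the $q$ (resp. only the $p$) variables. A tilde over an operator means $D_x,D_t$ are replaced by $\tilde D_x,\tilde D_t$; $A$, $R$ in the brackets below are so lifted. For $A=\|\sum_i a^l_{ij}D_x^i\|$, $R=\|\sum_i r^l_{ij}D_x^i\|$ put $\mathcal{H}_A^l=\sum a^l_{ij}p^j_i$, $\mathcal{N}_R^l=\sum r^l_{ij}q^j_i$ (for invariant $A$ and $R$ these are shadows: $\tilde\ell_{\mathcal{E}}(\mathcal{H}_A)=0$, $\tilde\ell_{\mathcal{E}}(\mathcal{N}_R)=0$). For a vector function $\mathcal{G}$: $\tilde\ell_{\mathcal{G}}(\chi)^l=\sum\frac{\partial\mathcal{G}^l}{\partial u^j_k}\tilde D_x^k(\chi^j)$, $\tilde\ell^*_{\mathcal{G}}(p)^j=\sum(-1)^k\tilde D_x^k\bigl(\frac{\partial\mathcal{G}^l}{\partial u^j_k}p^l\bigr)$ (factors in the order written), and $\tilde\ell_{R^*,p}(q)$ denotes $\tilde\ell_{\mathcal{G}}(q)$ for $\mathcal{G}=R^*(p)$. The brackets are $$\{\mathcal{H}_A,\mathcal{H}_B\}=-\tilde\ell_{\mathcal{H}_A}(\mathcal{H}_B)-\tilde\ell_{\mathcal{H}_B}(\mathcal{H}_A)-\tfrac12\bigl(A(\tilde\ell^*_{\mathcal{H}_B}(p))+B(\tilde\ell^*_{\mathcal{H}_A}(p))\bigr),$$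 $$\{\mathcal{N}_R,\mathcal{N}_S\}=-\tilde\ell_{\mathcal{N}_R}(\mathcal{N}_S)-\tilde\ell_{\mathcal{N}_S}(\mathcal{N}_R)+R(\tilde\ell_{\mathcal{N}_S}(q))+S(\tilde\ell_{\mathcal{N}_R}(q)),$$ $$\{\mathcal{H}_A,\mathcal{N}_R\}=-\tilde\ell_{\mathcal{N}_R}(\mathcal{H}_A)-\tilde\ell_{\mathcal{H}_A}(\mathcal{N}_R)-A\bigl(\tilde\ell^*_{\mathcal{N}_R}(p)+\tilde\ell_{R^*,p}(q)\bigr)+R(\tilde\ell_{\mathcal{H}_A}(q)).$$ *)

theory Defs
  imports "HOL-Analysis.Analysis" "HOL-Library.Poly_Mapping" "HOL-Library.FSet"
begin

section \<open>Smooth functions on the infinite jet space\<close>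

text \<open>
  A point of the equation manifold assigns a real number to each of the coordinates
  \<open>x\<close>, \<open>t\<close> and \<open>u\<^sup>j\<^sub>k\<close>.  The components \<open>j\<close> of the
  unknown range over an arbitrary finite type \<open>'m\<close>, so \<open>m = CARD('m)\<close>.
\<close>

datatype 'm coord = Cx | Ct | Cu 'm nat

definition partial :: "'c \<Rightarrow> (('c \<Rightarrow> real) \<Rightarrow> real) \<Rightarrow> ('c \<Rightarrow> real) \<Rightarrow> real"
  where "partial c g = (\<lambda>v. deriv (\<lambda>s. g (v(c := s))) (v c))"

text \<open>
  Continuity refers to the product topology; for functions of finitely many coordinates this is
  continuity in these coordinates.
\<close>

primrec C_k :: "nat \<Rightarrow> (('c \<Rightarrow> real) \<Rightarrow> real) \<Rightarrow> bool" where
  "C_k 0 g \<longleftrightarrow> continuous_on UNIV g"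
| "C_k (Suc n) g \<longleftrightarrow> continuous_on UNIV g \<and>
     (\<forall>c v. (\<lambda>s. g (v(c := s))) differentiable at (v c)) \<and> (\<forall>c. C_k n (partial c g))"

definition depends_on :: "'c set \<Rightarrow> (('c \<Rightarrow> real) \<Rightarrow> real) \<Rightarrow> bool"
  where "depends_on S g \<longleftrightarrow> (\<forall>v w. (\<forall>c\<in>S. v c = w c) \<longrightarrow> g v = g w)"

definition smooth :: "(('c \<Rightarrow> real) \<Rightarrow> real) \<Rightarrow> bool"
  where "smooth g \<longleftrightarrow> (\<exists>S. finite S \<and> depends_on S g) \<and> (\<forall>n. C_k n g)"

lemma C_k_Suc_imp: "C_k (Suc n) g \<Longrightarrow> C_k n g"
  by (induction n arbitrary: g) auto

lemma C_k_continuous: "C_k n g \<Longrightarrow> continuous_on UNIV g"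
  by (cases n) auto

lemma partial_const [simp]: "partial c (\<lambda>_. r) = (\<lambda>_. 0)"
  by (simp add: partial_def)

lemma C_k_const: "C_k n (\<lambda>_. r)"
  by (induction n arbitrary: r) auto

lemma partial_coordinate: "partial c (\<lambda>v. v d) = (\<lambda>_. if c = d then 1 else 0)"
proof (cases "c = d")
  case False
  then have "(\<lambda>s. (v(c := s)) d) = (\<lambda>s. v d)" for v :: "'a \<Rightarrow> real"
    by auto
  then show ?thesis
    using False by (simp add: partial_def)
qed (simp add: partial_def)

lemma C_k_coordinate: "C_k n (\<lambda>v. v d)"
proof (cases n)
  case (Suc k)
  have "(\<lambda>s. (v(c := s)) d) differentiable at (v c)" for c and v :: "'a \<Rightarrow> real"
    by (cases "c = d") auto
  then show ?thesis
    using Suc by (auto simp: partial_coordinate C_k_const simp del: fun_upd_apply)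
qed simp

lemma partial_has_derivative:
  assumes "\<forall>c v. (\<lambda>s. g (v(c := s))) differentiable at (v c)"
  shows "((\<lambda>s. g (v(c := s))) has_field_derivative partial c g v) (at (v c))"
  using assms by (simp add: partial_def DERIV_deriv_iff_real_differentiable)

lemma partial_add:
  assumes "\<forall>c v. (\<lambda>s. g (v(c := s))) differentiable at (v c)"
    and "\<forall>c v. (\<lambda>s. h (v(c := s))) differentiable at (v c)"
  shows "partial c (\<lambda>v. g v + h v) = (\<lambda>v. partial c g v + partial c h v)"
proof
  fix v
  show "partial c (\<lambda>v. g v + h v) v = partial c g v + partial c h v"
    unfolding partial_def[of c "\<lambda>v. g v + h v"]
    by (rule DERIV_imp_deriv, rule DERIV_add) (rule partial_has_derivative assms)+
qed

lemma partial_mult: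
  assumes "\<forall>c v. (\<lambda>s. g (v(c := s))) differentiable at (v c)"
    and "\<forall>c v. (\<lambda>s. h (v(c := s))) differentiable at (v c)"
  shows "partial c (\<lambda>v. g v * h v) = (\<lambda>v. partial c g v * h v + g v * partial c h v)"
proof
  fix v
  show "partial c (\<lambda>v. g v * h v) v = partial c g v * h v + g v * partial c h v"
    unfolding partial_def[of c "\<lambda>v. g v * h v"]
    using DERIV_mult'[OF partial_has_derivative[OF assms(1), of v c]
        partial_has_derivative[OF assms(2), of v c]]
    by (intro DERIV_imp_deriv) (simp only: fun_upd_triv ac_simps)
qed

lemma C_k_add: "C_k n g \<Longrightarrow> C_k n h \<Longrightarrow> C_k n (\<lambda>v. g v + h v)"
proof (induction n arbitrary: g h)
  case 0
  then show ?case by (simp add: continuous_on_add)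
next
  case (Suc n)
  then show ?case by (simp add: continuous_on_add partial_add)
qed

lemma C_k_mult: "C_k n g \<Longrightarrow> C_k n h \<Longrightarrow> C_k n (\<lambda>v. g v * h v)"
proof (induction n arbitrary: g h)
  case 0
  then show ?case by (simp add: continuous_on_mult)
next
  case (Suc n)
  then have "C_k n g" "C_k n h"
    using C_k_Suc_imp by auto
  with Suc show ?case
    by (simp add: continuous_on_mult partial_mult C_k_add)
qed

lemma C_k_diff: "C_k n g \<Longrightarrow> C_k n h \<Longrightarrow> C_k n (\<lambda>v. g v - h v)"
  using C_k_add[of n g "\<lambda>v. - 1 * h v"] C_k_mult[OF C_k_const[of n "-1"], of h] by simp

lemma depends_on_comb:
  assumes "depends_on S g" "depends_on S' h"
  shows "depends_on (S \<union> S') (\<lambda>v. F (g v) (h v))"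
  unfolding depends_on_def
proof (intro allI impI)
  fix v w :: "'a \<Rightarrow> real"
  assume "\<forall>c\<in>S \<union> S'. v c = w c"
  then have "g v = g w" "h v = h w"
    using assms unfolding depends_on_def by blast+
  then show "F (g v) (h v) = F (g w) (h w)"
    by simp
qed

lemma partial_eq_0:
  assumes "depends_on S g" "c \<notin> S"
  shows "partial c g = (\<lambda>_. 0)"
proof
  fix v
  have "(\<lambda>s. g (v(c := s))) = (\<lambda>s. g v)"
    using assms unfolding depends_on_def by (auto intro!: ext)
  then show "partial c g v = 0"
    by (simp add: partial_def)
qed

lemma depends_on_partial:
  assumes "depends_on S g"
  shows "depends_on S (partial c g)"
proof (cases "c \<in> S")
  case True
  show ?thesis
    unfolding depends_on_def
  proof (intro allI impI)
    fix v w :: "'a \<Rightarrow> real"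
    assume eq: "\<forall>c\<in>S. v c = w c"
    then have "\<forall>d\<in>S. (v(c := s)) d = (w(c := s)) d" for s
      by simp
    then have "g (v(c := s)) = g (w(c := s))" for s
      using assms unfolding depends_on_def by blast
    then show "partial c g v = partial c g w"
      using eq True by (simp add: partial_def)
  qed
next
  case False
  then show ?thesis
    using partial_eq_0[OF assms] by (simp add: depends_on_def)
qed

lemma smooth_const: "smooth (\<lambda>_. r)"
proof -
  have "depends_on {} (\<lambda>_. r)"
    by (simp add: depends_on_def)
  then show ?thesis
    unfolding smooth_def by (intro conjI exI[of _ "{}"]) (simp_all add: C_k_const)
qed

lemma smooth_coordinate: "smooth (\<lambda>v. v d)"
proof -
  have "depends_on {d} (\<lambda>v. v d)"
    by (simp add: depends_on_def)
  then show ?thesis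
    unfolding smooth_def by (intro conjI exI[of _ "{d}"]) (simp_all add: C_k_coordinate)
qed

lemma smooth_comb:
  assumes "smooth g" "smooth h" "\<And>n. C_k n g \<Longrightarrow> C_k n h \<Longrightarrow> C_k n (\<lambda>v. F (g v) (h v))"
  shows "smooth (\<lambda>v. F (g v) (h v))"
proof -
  obtain S S' where "finite S" "depends_on S g" "finite S'" "depends_on S' h"
    using assms(1,2) unfolding smooth_def by blast
  then have "finite (S \<union> S') \<and> depends_on (S \<union> S') (\<lambda>v. F (g v) (h v))"
    using depends_on_comb by blast
  then show ?thesis
    using assms unfolding smooth_def by blast
qed

lemma smooth_add: "smooth g \<Longrightarrow> smooth h \<Longrightarrow> smooth (\<lambda>v. g v + h v)"
  by (rule smooth_comb[where F = "(+)"]) (auto intro: C_k_add)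

lemma smooth_mult: "smooth g \<Longrightarrow> smooth h \<Longrightarrow> smooth (\<lambda>v. g v * h v)"
  by (rule smooth_comb[where F = "(*)"]) (auto intro: C_k_mult)

lemma smooth_uminus: "smooth g \<Longrightarrow> smooth (\<lambda>v. - g v)"
  using smooth_mult[OF smooth_const[of "-1"]] by simp

lemma smooth_partial:
  assumes "smooth g"
  shows "smooth (partial c g)"
proof -
  obtain S where "finite S" "depends_on S g"
    using assms unfolding smooth_def by blast
  then have "finite S \<and> depends_on S (partial c g)"
    by (simp add: depends_on_partial)
  moreover have "C_k n (partial c g)" for n
    using assms C_k.simps(2)[of n g] unfolding smooth_def by blast
  ultimately show ?thesis
    unfolding smooth_def by (intro conjI exI[of _ S]) simp_all
qed

typedef 'm dfun = "{g :: ('m coord \<Rightarrow> real) \<Rightarrow> real. smooth g}"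
  morphisms dfun_at Dfun
  by (intro exI[of _ "\<lambda>_. 0"] CollectI smooth_const)

setup_lifting type_definition_dfun

instantiation dfun :: (type) comm_ring_1
begin

lift_definition zero_dfun :: "'a dfun" is "\<lambda>_. 0" by (rule smooth_const)
lift_definition one_dfun :: "'a dfun" is "\<lambda>_. 1" by (rule smooth_const)
lift_definition plus_dfun :: "'a dfun \<Rightarrow> 'a dfun \<Rightarrow> 'a dfun" is "\<lambda>g h v. g v + h v"
  by (rule smooth_add)
lift_definition times_dfun :: "'a dfun \<Rightarrow> 'a dfun \<Rightarrow> 'a dfun" is "\<lambda>g h v. g v * h v"
  by (rule smooth_mult)
lift_definition uminus_dfun :: "'a dfun \<Rightarrow> 'a dfun" is "\<lambda>g v. - g v"
  by (rule smooth_uminus)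
lift_definition minus_dfun :: "'a dfun \<Rightarrow> 'a dfun \<Rightarrow> 'a dfun" is "\<lambda>g h v. g v - h v"
  by (rule smooth_comb[where F = "(-)"]) (auto intro: C_k_diff)

instance
  by standard (transfer; auto simp: algebra_simps fun_eq_iff)+

end

lift_definition dconst :: "real \<Rightarrow> 'm dfun" is "\<lambda>r _. r" by (rule smooth_const)
lift_definition dcoord :: "'m coord \<Rightarrow> 'm dfun" is "\<lambda>c v. v c" by (rule smooth_coordinate)
lift_definition pd :: "'m coord \<Rightarrow> 'm dfun \<Rightarrow> 'm dfun" is partial by (rule smooth_partial)

lemma finite_pd: "finite {c. pd c g \<noteq> 0}"
proof -
  obtain S where S: "finite S" "depends_on S (dfun_at g)"
    using dfun_at[of g] unfolding smooth_def by blast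
  have "pd c g = 0" if "c \<notin> S" for c
    using partial_eq_0[OF S(2) that] by (simp add: dfun_at_inject[symmetric] pd.rep_eq zero_dfun.rep_eq)
  then show ?thesis
    by (intro finite_subset[OF _ S(1)]) blast
qed

lemma finite_pd_Cu: "finite {k. pd (Cu j k) g \<noteq> 0}"
  using finite_vimageI[OF finite_pd, of "Cu j" g] by (simp add: inj_def vimage_def)

section \<open>Total derivatives, C-differential operators and their brackets\<close>

text \<open>
  All sums over \<open>k\<close> with \<open>Sum_any\<close> have only finitely many non-zero terms, because
  an element of \<open>dfun\<close> depends on finitely many coordinates.
\<close>

type_synonym 'm vfun = "('m dfun, 'm) vec"

definition Dx :: "'m::finite dfun \<Rightarrow> 'm dfun"
  where "Dx g = pd Cx g + (\<Sum>j\<in>UNIV. Sum_any (\<lambda>k. dcoord (Cu j (Suc k)) * pd (Cu j k) g))"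

definition Ev :: "'m::finite vfun \<Rightarrow> 'm dfun \<Rightarrow> 'm dfun"
  where "Ev \<phi> g = (\<Sum>j\<in>UNIV. Sum_any (\<lambda>k. (Dx ^^ k) (\<phi> $ j) * pd (Cu j k) g))"

definition Dt :: "'m::finite vfun \<Rightarrow> 'm dfun \<Rightarrow> 'm dfun"
  where "Dt f g = pd Ct g + Ev f g"

definition Ev_vec :: "'m::finite vfun \<Rightarrow> 'm vfun \<Rightarrow> 'm vfun"
  where "Ev_vec \<phi> \<psi> = (\<chi> l. Ev \<phi> (\<psi> $ l))"

definition Dt_vec :: "'m::finite vfun \<Rightarrow> 'm vfun \<Rightarrow> 'm vfun"
  where "Dt_vec f \<psi> = (\<chi> l. Dt f (\<psi> $ l))"

definition jacobi :: "'m::finite vfun \<Rightarrow> 'm vfun \<Rightarrow> 'm vfun"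
  where "jacobi \<phi> \<psi> = Ev_vec \<phi> \<psi> - Ev_vec \<psi> \<phi>"

text \<open>
  A scalar operator \<open>\<Sum>\<^sub>i a\<^sub>i D\<^sub>x\<^sup>i\<close> is given by its finitely supported
  coefficient sequence, a matrix operator \<open>A\<close> by the entries \<open>A $ l $ j\<close>
  (row \<open>l\<close>, column \<open>j\<close>).  Only the additive structure of \<open>nat \<Rightarrow>\<^sub>0 dfun\<close>
  is used, not its (commutative) convolution product.
\<close>

type_synonym 'm sop = "nat \<Rightarrow>\<^sub>0 'm dfun"
type_synonym 'm cdo = "(('m sop, 'm) vec, 'm) vec"

definition sapp :: "'m::finite sop \<Rightarrow> 'm dfun \<Rightarrow> 'm dfun"
  where "sapp a g = (\<Sum>i\<in>Poly_Mapping.keys a. Poly_Mapping.lookup a i * (Dx ^^ i) g)"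

definition app :: "'m::finite cdo \<Rightarrow> 'm vfun \<Rightarrow> 'm vfun"
  where "app A \<psi> = (\<chi> l. \<Sum>j\<in>UNIV. sapp (A $ l $ j) (\<psi> $ j))"

text \<open>
  The scalar adjoint is \<open>\<Sum>\<^sub>i (-1)\<^sup>i D\<^sub>x\<^sup>i \<circ> a\<^sub>i\<close>, brought to normal
  form by the Leibniz rule; see \<open>sapp_sadj\<close> below.
\<close>

definition sadj :: "'m::finite sop \<Rightarrow> 'm sop"
  where "sadj a = (\<Sum>i\<in>Poly_Mapping.keys a. \<Sum>s\<le>i. Poly_Mapping.single s
           ((-1) ^ i * of_nat (i choose s) * (Dx ^^ (i - s)) (Poly_Mapping.lookup a i)))"

definition adj :: "'m::finite cdo \<Rightarrow> 'm cdo"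
  where "adj A = (\<chi> l j. sadj (A $ j $ l))"

lift_definition slin :: "'m dfun \<Rightarrow> 'm \<Rightarrow> 'm sop" is "\<lambda>g j k. pd (Cu j k) g"
  by (rule finite_pd_Cu)

text \<open>
  The linearization of \<open>\<psi>\<close> and, for an operator \<open>\<Delta>\<close>, the operator
  \<open>\<phi> \<mapsto> Ev \<phi> (\<Delta>) (\<psi>)\<close>, as C-differential operators; see
  \<open>app_lin\<close> and \<open>app_lin_op\<close> below.
\<close>

definition lin :: "'m::finite vfun \<Rightarrow> 'm cdo"
  where "lin \<psi> = (\<chi> l j. slin (\<psi> $ l) j)"

definition lin_op :: "'m::finite cdo \<Rightarrow> 'm vfun \<Rightarrow> 'm cdo"
  where "lin_op \<Delta> \<psi> = (\<chi> l j. \<Sum>s\<in>UNIV. \<Sum>i\<in>Poly_Mapping.keys (\<Delta> $ l $ s).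
           Poly_Mapping.map (\<lambda>c. c * (Dx ^^ i) (\<psi> $ s))
             (slin (Poly_Mapping.lookup (\<Delta> $ l $ s) i) j))"

definition Ev_op :: "'m::finite vfun \<Rightarrow> 'm cdo \<Rightarrow> 'm cdo"
  where "Ev_op \<phi> \<Delta> = (\<chi> l j. Poly_Mapping.map (Ev \<phi>) (\<Delta> $ l $ j))"

lemma Sum_any_finite_UNIV_supset:
  "finite I \<Longrightarrow> (\<And>k. k \<notin> I \<Longrightarrow> g k = 0) \<Longrightarrow> Sum_any g = sum g I"
  by (rule Sum_any.expand_superset) auto

lemma pd_add: "pd c (g + h) = pd c g + pd c h"
  by transfer (rule partial_add; metis smooth_def C_k.simps(2))

lemma pd_mult: "pd c (g * h) = pd c g * h + g * pd c h"
  by transfer (rule partial_mult; metis smooth_def C_k.simps(2))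

lemma pd_0 [simp]: "pd c 0 = 0"
  using pd_add[of c 0 0] by simp

lemma finite_pd_Cu_mult: "finite {k. w k * pd (Cu j k) g \<noteq> 0}"
  by (rule finite_subset[OF _ finite_pd_Cu[of j g]]) auto

lemma Sum_any_pd_add:
  "Sum_any (\<lambda>k. w k * pd (Cu j k) (g + h)) =
     Sum_any (\<lambda>k. w k * pd (Cu j k) g) + Sum_any (\<lambda>k. w k * pd (Cu j k) h)"
  by (simp add: pd_add distrib_left Sum_any.distrib finite_pd_Cu_mult)

lemma Sum_any_pd_mult:
  "Sum_any (\<lambda>k. w k * pd (Cu j k) (g * h)) =
     Sum_any (\<lambda>k. w k * pd (Cu j k) g) * h + g * Sum_any (\<lambda>k. w k * pd (Cu j k) h)"
proof -
  have fin: "finite {k. w k * pd (Cu j k) g * h \<noteq> 0}" "finite {k. g * (w k * pd (Cu j k) h) \<noteq> 0}"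
    by (rule finite_subset[OF _ finite_pd_Cu_mult[of w j g]]; force)
       (rule finite_subset[OF _ finite_pd_Cu_mult[of w j h]]; force)
  have "w k * pd (Cu j k) (g * h) = w k * pd (Cu j k) g * h + g * (w k * pd (Cu j k) h)" for k
    by (simp add: pd_mult algebra_simps)
  then have "Sum_any (\<lambda>k. w k * pd (Cu j k) (g * h)) =
      Sum_any (\<lambda>k. w k * pd (Cu j k) g * h) + Sum_any (\<lambda>k. g * (w k * pd (Cu j k) h))"
    using Sum_any.distrib[OF fin] by simp
  then show ?thesis
    by (simp add: Sum_any_left_distrib Sum_any_right_distrib finite_pd_Cu_mult)
qed

lemma Dx_add: "Dx (g + h) = Dx g + Dx h"
  by (simp add: Dx_def pd_add[of Cx] Sum_any_pd_add sum.distrib)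

lemma Dx_mult: "Dx (g * h) = Dx g * h + g * Dx h"
  by (simp add: Dx_def pd_mult[of Cx] Sum_any_pd_mult sum.distrib sum_distrib_left
      sum_distrib_right algebra_simps)

lemma Dx_0 [simp]: "Dx 0 = 0"
  using Dx_add[of 0 0] by simp

lemma Dx_sum: "Dx (sum g I) = (\<Sum>i\<in>I. Dx (g i))"
  by (induction I rule: infinite_finite_induct) (simp_all add: Dx_add)

lemma Dx_of_nat_mult: "Dx (of_nat n * g) = of_nat n * Dx g"
  by (induction n) (simp_all add: distrib_right Dx_add)

lemma Dx_pow_mult:
  "(Dx ^^ n) (g * h) = (\<Sum>s\<le>n. of_nat (n choose s) * ((Dx ^^ (n - s)) g * (Dx ^^ s) h))"
proof (induction n)
  case (Suc n)
  let ?t = "\<lambda>i s. (Dx ^^ i) g * (Dx ^^ s) h"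
  have "(Dx ^^ Suc n) (g * h) =
      (\<Sum>s\<le>n. of_nat (n choose s) * ?t (Suc (n - s)) s) +
      (\<Sum>s\<le>n. of_nat (n choose s) * ?t (n - s) (Suc s))"
    by (simp add: Suc Dx_sum Dx_of_nat_mult Dx_mult[of "(Dx ^^ _) g"] distrib_left sum.distrib)
  also have "(\<Sum>s\<le>n. of_nat (n choose s) * ?t (Suc (n - s)) s) =
      (\<Sum>s\<le>Suc n. of_nat (n choose s) * ?t (Suc n - s) s)"
    by (auto simp: Suc_diff_le binomial_eq_0 intro!: sum.cong)
  also have "\<dots> = ?t (Suc n) 0 + (\<Sum>s\<le>n. of_nat (n choose Suc s) * ?t (n - s) (Suc s))"
    by (subst sum.atMost_Suc_shift) simp
  finally have "(Dx ^^ Suc n) (g * h) = ?t (Suc n) 0 +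
      (\<Sum>s\<le>n. of_nat (Suc n choose Suc s) * ?t (n - s) (Suc s))"
    by (simp add: sum.distrib[symmetric] distrib_right add.assoc add.commute del: funpow.simps)
  also have "\<dots> = (\<Sum>s\<le>Suc n. of_nat (Suc n choose s) * ?t (Suc n - s) s)"
    by (subst sum.atMost_Suc_shift) simp
  finally show ?case .
qed simp

lemma sapp_supset:
  assumes "finite I" "Poly_Mapping.keys a \<subseteq> I"
  shows "sapp a g = (\<Sum>i\<in>I. Poly_Mapping.lookup a i * (Dx ^^ i) g)"
  unfolding sapp_def using assms by (intro sum.mono_neutral_left) (auto simp: in_keys_iff)

lemma sapp_add: "sapp (a + b) g = sapp a g + sapp b g"
proof -
  let ?I = "Poly_Mapping.keys a \<union> Poly_Mapping.keys b"
  have "Poly_Mapping.keys (a + b) \<subseteq> ?I"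
    by (rule Poly_Mapping.keys_add)
  then show ?thesis
    by (simp add: sapp_supset[of ?I] lookup_add distrib_right sum.distrib)
qed

lemma sapp_0 [simp]: "sapp 0 g = 0"
  by (simp add: sapp_def)

lemma sapp_sum: "sapp (sum a I) g = (\<Sum>i\<in>I. sapp (a i) g)"
  by (induction I rule: infinite_finite_induct) (simp_all add: sapp_add)

lemma sapp_single: "sapp (Poly_Mapping.single i c) g = c * (Dx ^^ i) g"
  by (simp add: sapp_def)

lemma sapp_sadj:
  "sapp (sadj a) g =
     (\<Sum>i\<in>Poly_Mapping.keys a. (-1) ^ i * (Dx ^^ i) (Poly_Mapping.lookup a i * g))"
  by (simp add: sadj_def sapp_sum sapp_single Dx_pow_mult sum_distrib_left mult.assoc)

lemma sapp_slin: "sapp (slin g j) h = Sum_any (\<lambda>k. (Dx ^^ k) h * pd (Cu j k) g)"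
proof -
  have "Sum_any (\<lambda>k. (Dx ^^ k) h * pd (Cu j k) g) =
      (\<Sum>k\<in>Poly_Mapping.keys (slin g j). (Dx ^^ k) h * pd (Cu j k) g)"
    by (rule Sum_any.expand_superset) (auto simp: in_keys_iff slin.rep_eq)
  then show ?thesis
    by (simp add: sapp_def slin.rep_eq mult.commute)
qed

lemma Ev_eq_sapp: "Ev \<phi> g = (\<Sum>j\<in>UNIV. sapp (slin g j) (\<phi> $ j))"
  by (simp add: Ev_def sapp_slin)

lemma app_lin: "app (lin \<psi>) \<phi> = Ev_vec \<phi> \<psi>"
  by (simp add: app_def lin_def Ev_vec_def Ev_eq_sapp)

lemma sapp_map_mult: "sapp (Poly_Mapping.map (\<lambda>c. c * r) a) g = sapp a g * r"
proof -
  have "Poly_Mapping.keys (Poly_Mapping.map (\<lambda>c. c * r) a) \<subseteq> Poly_Mapping.keys a"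
    by (auto simp: in_keys_iff map.rep_eq when_def)
  then have "sapp (Poly_Mapping.map (\<lambda>c. c * r) a) g =
      (\<Sum>i\<in>Poly_Mapping.keys a. Poly_Mapping.lookup a i * r * (Dx ^^ i) g)"
    by (subst sapp_supset[of "Poly_Mapping.keys a"]) (simp_all add: map.rep_eq when_def in_keys_iff)
  then show ?thesis
    unfolding sapp_def[of a] sum_distrib_right by (simp add: mult_ac)
qed

lemma Ev_0 [simp]: "Ev \<phi> 0 = 0"
  by (simp add: Ev_def)

lemma app_lin_op: "app (lin_op \<Delta> \<psi>) \<phi> = app (Ev_op \<phi> \<Delta>) \<psi>"
proof -
  have "(\<Sum>j\<in>UNIV. sapp (lin_op \<Delta> \<psi> $ l $ j) (\<phi> $ j)) =
      (\<Sum>s\<in>UNIV. sapp (Ev_op \<phi> \<Delta> $ l $ s) (\<psi> $ s))" for l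
  proof -
    have "(\<Sum>j\<in>UNIV. sapp (lin_op \<Delta> \<psi> $ l $ j) (\<phi> $ j)) =
        (\<Sum>j\<in>UNIV. \<Sum>s\<in>UNIV. \<Sum>i\<in>Poly_Mapping.keys (\<Delta> $ l $ s).
           sapp (slin (Poly_Mapping.lookup (\<Delta> $ l $ s) i) j) (\<phi> $ j) * (Dx ^^ i) (\<psi> $ s))"
      by (simp add: lin_op_def sapp_sum sapp_map_mult)
    also have "\<dots> = (\<Sum>s\<in>UNIV. \<Sum>j\<in>UNIV. \<Sum>i\<in>Poly_Mapping.keys (\<Delta> $ l $ s).
           sapp (slin (Poly_Mapping.lookup (\<Delta> $ l $ s) i) j) (\<phi> $ j) * (Dx ^^ i) (\<psi> $ s))"
      by (rule sum.swap)
    also have "\<dots> = (\<Sum>s\<in>UNIV. \<Sum>i\<in>Poly_Mapping.keys (\<Delta> $ l $ s).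
           Ev \<phi> (Poly_Mapping.lookup (\<Delta> $ l $ s) i) * (Dx ^^ i) (\<psi> $ s))"
      by (simp add: Ev_eq_sapp sum_distrib_right sum.swap[of _ _ UNIV])
    also have "\<dots> = (\<Sum>s\<in>UNIV. sapp (Ev_op \<phi> \<Delta> $ l $ s) (\<psi> $ s))"
    proof (rule sum.cong[OF refl])
      fix s
      have "Poly_Mapping.keys (Ev_op \<phi> \<Delta> $ l $ s) \<subseteq> Poly_Mapping.keys (\<Delta> $ l $ s)"
        by (auto simp: Ev_op_def in_keys_iff map.rep_eq when_def)
      then show "(\<Sum>i\<in>Poly_Mapping.keys (\<Delta> $ l $ s).
           Ev \<phi> (Poly_Mapping.lookup (\<Delta> $ l $ s) i) * (Dx ^^ i) (\<psi> $ s)) =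
           sapp (Ev_op \<phi> \<Delta> $ l $ s) (\<psi> $ s)"
        by (subst sapp_supset[of "Poly_Mapping.keys (\<Delta> $ l $ s)"])
           (simp_all add: Ev_op_def map.rep_eq when_def in_keys_iff)
    qed
    finally show ?thesis .
  qed
  then show ?thesis
    by (simp add: app_def)
qed

definition Lie :: "'m::finite vfun \<Rightarrow> 'm vfun \<Rightarrow> 'm vfun"
  where "Lie \<phi> \<psi> = Ev_vec \<phi> \<psi> + app (adj (lin \<phi>)) \<psi>"

text \<open>
  The value of the pairing is the class of \<open>pairing \<psi> \<phi> dx\<close> modulo total derivatives;
  the Euler operator, which annihilates total derivatives, is evaluated on this representative.
\<close>

definition pairing :: "'m::finite vfun \<Rightarrow> 'm vfun \<Rightarrow> 'm dfun"
  where "pairing \<psi> \<phi> = (\<Sum>j\<in>UNIV. \<psi> $ j * \<phi> $ j)"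

definition euler :: "'m::finite dfun \<Rightarrow> 'm vfun"
  where "euler g = (\<chi> j. Sum_any (\<lambda>k. (-1) ^ k * (Dx ^^ k) (pd (Cu j k) g)))"

definition schouten :: "'m::finite cdo \<Rightarrow> 'm cdo \<Rightarrow> 'm vfun \<Rightarrow> 'm vfun \<Rightarrow> 'm vfun"
  where "schouten A B \<psi>\<^sub>1 \<psi>\<^sub>2 =
     - app (lin_op A \<psi>\<^sub>1) (app B \<psi>\<^sub>2) + app (lin_op A \<psi>\<^sub>2) (app B \<psi>\<^sub>1)
     - app A (app (adj (lin_op B \<psi>\<^sub>1)) \<psi>\<^sub>2)
     - app (lin_op B \<psi>\<^sub>1) (app A \<psi>\<^sub>2) + app (lin_op B \<psi>\<^sub>2) (app A \<psi>\<^sub>1)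
     - app B (app (adj (lin_op A \<psi>\<^sub>1)) \<psi>\<^sub>2)"

definition FN_bracket :: "'m::finite cdo \<Rightarrow> 'm cdo \<Rightarrow> 'm vfun \<Rightarrow> 'm vfun \<Rightarrow> 'm vfun"
  where "FN_bracket R S \<phi>\<^sub>1 \<phi>\<^sub>2 =
     jacobi (app R \<phi>\<^sub>1) (app S \<phi>\<^sub>2) + jacobi (app S \<phi>\<^sub>1) (app R \<phi>\<^sub>2)
     - app R (jacobi (app S \<phi>\<^sub>1) \<phi>\<^sub>2 + jacobi \<phi>\<^sub>1 (app S \<phi>\<^sub>2) - app S (jacobi \<phi>\<^sub>1 \<phi>\<^sub>2))
     - app S (jacobi (app R \<phi>\<^sub>1) \<phi>\<^sub>2 + jacobi \<phi>\<^sub>1 (app R \<phi>\<^sub>2) - app R (jacobi \<phi>\<^sub>1 \<phi>\<^sub>2))"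

definition hamiltonian :: "'m::finite cdo \<Rightarrow> bool"
  where "hamiltonian A \<longleftrightarrow> adj A = - A \<and> (\<forall>\<psi>\<^sub>1 \<psi>\<^sub>2. schouten A A \<psi>\<^sub>1 \<psi>\<^sub>2 = 0)"

definition nijenhuis :: "'m::finite cdo \<Rightarrow> bool"
  where "nijenhuis R \<longleftrightarrow> (\<forall>\<phi>\<^sub>1 \<phi>\<^sub>2. FN_bracket R R \<phi>\<^sub>1 \<phi>\<^sub>2 = 0)"

definition compatible :: "'m::finite cdo \<Rightarrow> 'm cdo \<Rightarrow> bool"
  where "compatible A R \<longleftrightarrow> (\<forall>\<psi>\<^sub>1 \<psi>\<^sub>2.
     Lie (app A \<psi>\<^sub>1) (app (adj R) \<psi>\<^sub>2) - Lie (app A \<psi>\<^sub>2) (app (adj R) \<psi>\<^sub>1)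
     + app (adj R) (Lie (app A \<psi>\<^sub>2) \<psi>\<^sub>1) - app (adj R) (Lie (app A \<psi>\<^sub>1) \<psi>\<^sub>2)
     + euler (pairing \<psi>\<^sub>1 (app A (app (adj R) \<psi>\<^sub>2)))
     - app (adj R) (euler (pairing \<psi>\<^sub>1 (app A \<psi>\<^sub>2))) = 0)"

text \<open>
  The linearization of \<open>F = u\<^sub>t - f\<close> and its formal adjoint.
\<close>

definition lin_F :: "'m::finite vfun \<Rightarrow> 'm vfun \<Rightarrow> 'm vfun"
  where "lin_F f \<phi> = Dt_vec f \<phi> - app (lin f) \<phi>"

definition lin_F_adj :: "'m::finite vfun \<Rightarrow> 'm vfun \<Rightarrow> 'm vfun"
  where "lin_F_adj f \<psi> = - Dt_vec f \<psi> - app (adj (lin f)) \<psi>"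

definition poisson_nijenhuis :: "'m::finite vfun \<Rightarrow> 'm cdo \<Rightarrow> 'm cdo \<Rightarrow> bool"
  where "poisson_nijenhuis f A R \<longleftrightarrow>
     hamiltonian A \<and> nijenhuis R \<and>
     (\<forall>\<psi>. app R (app A \<psi>) = app A (app (adj R) \<psi>)) \<and>
     compatible A R \<and>
     (\<forall>\<psi>. lin_F f (app A \<psi>) + app A (lin_F_adj f \<psi>) = 0) \<and>
     (\<forall>\<phi>. lin_F f (app R \<phi>) - app R (lin_F f \<phi>) = 0)"

section \<open>Grassmann algebras\<close>

text \<open>
  The Grassmann algebra over \<open>'r\<close> on the generators \<open>'g\<close>: the finite set
  \<open>{s\<^sub>1, \<dots>, s\<^sub>n}\<close> with \<open>to_nat s\<^sub>1 < \<dots> < to_nat s\<^sub>n\<close> stands for the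
  monomial \<open>s\<^sub>1 \<dots> s\<^sub>n\<close>.  The enumeration \<open>to_nat\<close> serves only as a fixed
  linear order on the generators.
\<close>

definition koszul :: "'g::countable fset \<Rightarrow> 'g fset \<Rightarrow> 'r::comm_ring_1"
  where "koszul S T =
     (if S |\<inter>| T = {||} then (-1) ^ card {(s, t). s |\<in>| S \<and> t |\<in>| T \<and> to_nat t < to_nat s} else 0)"

definition gmult :: "('g::countable fset \<Rightarrow>\<^sub>0 'r::comm_ring_1) \<Rightarrow> ('g fset \<Rightarrow>\<^sub>0 'r) \<Rightarrow> ('g fset \<Rightarrow>\<^sub>0 'r)"
    (infixl \<open>\<odot>\<close> 70)
  where "a \<odot> b = (\<Sum>S\<in>Poly_Mapping.keys a. \<Sum>T\<in>Poly_Mapping.keys b.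
     Poly_Mapping.single (S |\<union>| T) (koszul S T * Poly_Mapping.lookup a S * Poly_Mapping.lookup b T))"

definition gscale :: "'r::comm_ring_1 \<Rightarrow> ('g fset \<Rightarrow>\<^sub>0 'r) \<Rightarrow> ('g fset \<Rightarrow>\<^sub>0 'r)"
  where "gscale c a = Poly_Mapping.map (\<lambda>r. c * r) a"

definition gen :: "'g \<Rightarrow> ('g fset \<Rightarrow>\<^sub>0 'r::comm_ring_1)"
  where "gen s = Poly_Mapping.single {|s|} 1"

text \<open>The left derivative with respect to the generator \<open>s\<close>.\<close>

definition lderiv :: "'g::countable \<Rightarrow> ('g fset \<Rightarrow>\<^sub>0 'r::comm_ring_1) \<Rightarrow> ('g fset \<Rightarrow>\<^sub>0 'r)"
  where "lderiv s a = (\<Sum>S\<in>{S \<in> Poly_Mapping.keys a. s |\<in>| S}.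
     Poly_Mapping.single (S |-| {|s|}) (koszul {|s|} (S |-| {|s|}) * Poly_Mapping.lookup a S))"

lemma gen_odot_gen:
  "gen s \<odot> gen t = Poly_Mapping.single {|s, t|}
     (if s = t then 0 else if to_nat t < to_nat s then -1 else (1 :: 'r::comm_ring_1))"
proof -
  have "{(a, b). a |\<in>| {|s|} \<and> b |\<in>| {|t|} \<and> to_nat b < to_nat a} =
      (if to_nat t < to_nat s then {(s, t)} else {})"
    by auto
  then show ?thesis
    by (simp add: gmult_def gen_def koszul_def finsert_commute) 
qed

lemma gen_anticommute: "gen s \<odot> gen t = - (gen t \<odot> (gen s :: 'g::countable fset \<Rightarrow>\<^sub>0 'r::comm_ring_1))"
proof (cases "s = t")
  case False
  then have "to_nat s \<noteq> to_nat t"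
    by simp
  then show ?thesis
    by (auto simp: gen_odot_gen finsert_commute single_uminus[symmetric] not_less_iff_gr_or_eq)
qed (simp add: gen_odot_gen)

lemma koszul_empty: "koszul S {||} = 1"
proof -
  have "{(s, t). s |\<in>| S \<and> t |\<in>| {||} \<and> to_nat t < to_nat s} = {}"
    by simp
  then show ?thesis
    unfolding koszul_def by simp
qed

lemma lderiv_gen:
  "lderiv s (gen t :: 'g::countable fset \<Rightarrow>\<^sub>0 'r::comm_ring_1) =
    (if s = t then Poly_Mapping.single {||} 1 else 0)"
proof -
  have "{S \<in> Poly_Mapping.keys (gen t :: 'g fset \<Rightarrow>\<^sub>0 'r). s |\<in>| S} = (if s = t then {{|t|}} else {})"
    by (auto simp: gen_def)
  then show ?thesis
    by (simp add: lderiv_def koszul_empty) (simp add: gen_def)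
qed

lemma gen_odot_1: "gen s \<odot> Poly_Mapping.single {||} 1 = gen s"
  by (simp add: gmult_def gen_def koszul_empty)

section \<open>The coverings and the brackets of shadows\<close>

text \<open>The fibre coordinates \<open>q\<^sup>j\<^sub>k\<close> and \<open>p\<^sup>j\<^sub>k\<close>.\<close>

datatype 'm oddvar = Oq 'm nat | Op 'm nat

instance oddvar :: (countable) countable
  by countable_datatype

type_synonym 'm sfun = "'m oddvar fset \<Rightarrow>\<^sub>0 'm dfun"
type_synonym 'm vsfun = "('m sfun, 'm) vec"

definition qv :: "'m::finite vsfun"
  where "qv = (\<chi> j. gen (Oq j 0))"

definition pv :: "'m::finite vsfun"
  where "pv = (\<chi> j. gen (Op j 0))"

text \<open>
  \<open>pd\<close> and \<open>Dx\<close> act on coefficients here; again, the sums over \<open>k\<close> are finite.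
\<close>

definition tpd :: "'m coord \<Rightarrow> 'm sfun \<Rightarrow> 'm sfun"
  where "tpd c = Poly_Mapping.map (pd c)"

definition tDx :: "'m::finite sfun \<Rightarrow> 'm sfun"
  where "tDx a = Poly_Mapping.map Dx a + (\<Sum>j\<in>UNIV. Sum_any (\<lambda>k.
     gen (Oq j (Suc k)) \<odot> lderiv (Oq j k) a + gen (Op j (Suc k)) \<odot> lderiv (Op j k) a))"

definition tapp :: "'m::finite cdo \<Rightarrow> 'm vsfun \<Rightarrow> 'm vsfun"
  where "tapp A \<chi>' = (\<chi> l. \<Sum>j\<in>UNIV. \<Sum>i\<in>Poly_Mapping.keys (A $ l $ j).
     gscale (Poly_Mapping.lookup (A $ l $ j) i) ((tDx ^^ i) (\<chi>' $ j)))"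

definition shadow_H :: "'m::finite cdo \<Rightarrow> 'm vsfun"
  where "shadow_H A = (\<chi> l. \<Sum>j\<in>UNIV. \<Sum>i\<in>Poly_Mapping.keys (A $ l $ j).
     gscale (Poly_Mapping.lookup (A $ l $ j) i) (gen (Op j i)))"

definition shadow_N :: "'m::finite cdo \<Rightarrow> 'm vsfun"
  where "shadow_N R = (\<chi> l. \<Sum>j\<in>UNIV. \<Sum>i\<in>Poly_Mapping.keys (R $ l $ j).
     gscale (Poly_Mapping.lookup (R $ l $ j) i) (gen (Oq j i)))"

lemma gmult_0 [simp]: "a \<odot> 0 = 0"
  by (simp add: gmult_def)

lemma pd_1 [simp]: "pd c 1 = 0"
  by transfer simp

lemma Dx_1 [simp]: "Dx 1 = 0"
  by (simp add: Dx_def)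

lemma map_Dx_gen: "Poly_Mapping.map Dx (gen s) = 0"
  by (rule poly_mapping_eqI) (simp add: gen_def map.rep_eq lookup_single when_def)

lemma tDx_gen:
  "tDx (gen (Oq j k)) = gen (Oq j (Suc k))" "tDx (gen (Op j k)) = gen (Op j (Suc k))"
proof -
  have *: "Sum_any (\<lambda>k'. if j' = j \<and> k' = k then g k' else 0) = (if j' = j then g k else 0)"
    for j' and g :: "nat \<Rightarrow> 'a sfun"
    by (subst Sum_any_finite_UNIV_supset[of "{k}"]) auto
  have "gen (Oq j' (Suc k')) \<odot> lderiv (Oq j' k') (gen (Oq j k)) +
      gen (Op j' (Suc k')) \<odot> lderiv (Op j' k') (gen (Oq j k)) =
      (if j' = j \<and> k' = k then gen (Oq j' (Suc k')) else (0 :: 'a sfun))" for j' k'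
    by (simp add: lderiv_gen gen_odot_1)
  then show "tDx (gen (Oq j k)) = gen (Oq j (Suc k))"
    by (simp add: tDx_def map_Dx_gen *)
  have "gen (Oq j' (Suc k')) \<odot> lderiv (Oq j' k') (gen (Op j k)) +
      gen (Op j' (Suc k')) \<odot> lderiv (Op j' k') (gen (Op j k)) =
      (if j' = j \<and> k' = k then gen (Op j' (Suc k')) else (0 :: 'a sfun))" for j' k'
    by (simp add: lderiv_gen gen_odot_1)
  then show "tDx (gen (Op j k)) = gen (Op j (Suc k))"
    by (simp add: tDx_def map_Dx_gen *)
qed

lemma tDx_pow_gen:
  "(tDx ^^ i) (gen (Oq j 0)) = gen (Oq j i)" "(tDx ^^ i) (gen (Op j 0)) = gen (Op j i)"
  by (induction i) (simp_all add: tDx_gen)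

lemma shadow_eq_tapp: "shadow_H A = tapp A pv" "shadow_N R = tapp R qv"
  by (simp_all add: shadow_H_def shadow_N_def tapp_def pv_def qv_def tDx_pow_gen)

definition tlin :: "'m::finite vsfun \<Rightarrow> 'm vsfun \<Rightarrow> 'm vsfun"
  where "tlin G \<chi>' = (\<chi> l. \<Sum>j\<in>UNIV. Sum_any (\<lambda>k. tpd (Cu j k) (G $ l) \<odot> (tDx ^^ k) (\<chi>' $ j)))"

definition tlin_adj :: "'m::finite vsfun \<Rightarrow> 'm vsfun \<Rightarrow> 'm vsfun"
  where "tlin_adj G \<pi> = (\<chi> j. \<Sum>l\<in>UNIV. Sum_any (\<lambda>k.
     gscale ((-1) ^ k) ((tDx ^^ k) (tpd (Cu j k) (G $ l) \<odot> \<pi> $ l))))"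

definition vscale :: "'m::finite dfun \<Rightarrow> 'm vsfun \<Rightarrow> 'm vsfun"
  where "vscale c G = (\<chi> l. gscale c (G $ l))"

definition bracket_HH :: "'m::finite cdo \<Rightarrow> 'm cdo \<Rightarrow> 'm vsfun"
  where "bracket_HH A B =
     - tlin (shadow_H A) (shadow_H B) - tlin (shadow_H B) (shadow_H A)
     - vscale (dconst (1/2)) (tapp A (tlin_adj (shadow_H B) pv) + tapp B (tlin_adj (shadow_H A) pv))"

definition bracket_NN :: "'m::finite cdo \<Rightarrow> 'm cdo \<Rightarrow> 'm vsfun"
  where "bracket_NN R S =
     - tlin (shadow_N R) (shadow_N S) - tlin (shadow_N S) (shadow_N R)
     + tapp R (tlin (shadow_N S) qv) + tapp S (tlin (shadow_N R) qv)"

definition bracket_HN :: "'m::finite cdo \<Rightarrow> 'm cdo \<Rightarrow> 'm vsfun"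
  where "bracket_HN A R =
     - tlin (shadow_N R) (shadow_H A) - tlin (shadow_H A) (shadow_N R)
     - tapp A (tlin_adj (shadow_N R) pv + tlin (tapp (adj R) pv) qv)
     + tapp R (tlin (shadow_H A) qv)"

end

theory Submission
  imports Defs
begin

text \<open>
  Every bracket is a vector of elements of degree two in the odd variables.  Such an element is
  evaluated on two pairs of sections \<open>(\<psi>\<^sub>1, \<phi>\<^sub>1)\<close> and
  \<open>(\<psi>\<^sub>2, \<phi>\<^sub>2)\<close> by substituting their jets for the variables \<open>p\<close> and \<open>q\<close> and
  alternating.  Evaluation turns \<open>tDx\<close> into \<open>Dx\<close>, and it is faithful, because sections that
  are polynomial in \<open>x\<close> realize arbitrary jets.  The evaluated brackets are: up to a factor the
  Schouten bracket of \<open>A\<close>, by skew-adjointness; up to a factor the Nijenhuis bracket of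
  \<open>R\<close>; and the alternation of an expression in \<open>(\<psi>, \<phi>)\<close> whose pairing with a further
  section \<open>\<psi>\<^sub>2\<close> is, modulo total derivatives, the pairing of \<open>\<phi>\<close> with the
  compatibility condition for \<open>\<psi>, \<psi>\<^sub>2\<close>.  The pairing is non-degenerate: the Euler
  operator annihilates total derivatives, and if it annihilates all \<open>g * h\<close>, then the choices of
  \<open>h\<close> as a polynomial in \<open>x\<close> and as \<open>u\<^sup>j\<close> give \<open>g = 0\<close>.
\<close>

section \<open>Total derivatives and evolutionary fields\<close>

lemma partial_has_derivative_upd:
  assumes "\<forall>c v. (\<lambda>s. g (v(c := s))) differentiable at (v c)"
  shows "((\<lambda>s. g (w(c := s))) has_field_derivative partial c g (w(c := s0))) (at s0)"
  using partial_has_derivative[OF assms, of "w(c := s0)" c] by (simp only: fun_upd_upd fun_upd_same)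

text \<open>Two applications of the mean value theorem: in direction \<open>c\<close> to the
  increment of \<open>g\<close> along \<open>d\<close>, then in direction \<open>d\<close> to
  \<open>partial c g\<close>. The left-hand side is unchanged when \<open>c, a\<close> and
  \<open>d, b\<close> change places, so it yields both mixed derivatives.\<close>

lemma second_difference:
  fixes g :: "('c \<Rightarrow> real) \<Rightarrow> real"
  assumes g: "C_k 2 g" and "c \<noteq> d" and h: "h > 0"
  obtains \<xi> \<eta> where "a < \<xi>" "\<xi> < a + h" "b < \<eta>" "\<eta> < b + h"
    "g (v(c := a + h, d := b + h)) - g (v(c := a, d := b + h))
       - (g (v(c := a + h, d := b)) - g (v(c := a, d := b)))
     = h * h * partial d (partial c g) (v(c := \<xi>, d := \<eta>))"
proof -
  have d1: "\<forall>c v. (\<lambda>s. g (v(c := s))) differentiable at (v c)"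
    and d2: "\<forall>e v. (\<lambda>s. partial c g (v(e := s))) differentiable at (v e)"
    using g by (simp_all add: numeral_2_eq_2)
  have comm: "v(c := s, d := t) = v(d := t, c := s)" for s t
    using \<open>c \<noteq> d\<close> by (rule fun_upd_twist)
  let ?\<phi> = "\<lambda>s. g (v(c := s, d := b + h)) - g (v(c := s, d := b))"
  let ?\<phi>' = "\<lambda>s. partial c g (v(c := s, d := b + h)) - partial c g (v(c := s, d := b))"
  have "(?\<phi> has_real_derivative ?\<phi>' s) (at s)" for s
    unfolding comm by (intro DERIV_diff partial_has_derivative_upd[OF d1])
  then obtain \<xi> where \<xi>: "a < \<xi>" "\<xi> < a + h" "?\<phi> (a + h) - ?\<phi> a = h * ?\<phi>' \<xi>"
    using MVT2[of a "a + h" ?\<phi> ?\<phi>'] h by auto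
  let ?\<chi> = "\<lambda>t. partial c g (v(c := \<xi>, d := t))"
  have "(?\<chi> has_real_derivative partial d (partial c g) (v(c := \<xi>, d := t))) (at t)" for t
    by (rule partial_has_derivative_upd[OF d2])
  then obtain \<eta> where "b < \<eta>" "\<eta> < b + h"
      "?\<chi> (b + h) - ?\<chi> b = h * partial d (partial c g) (v(c := \<xi>, d := \<eta>))"
    using MVT2[of b "b + h" ?\<chi> "\<lambda>t. partial d (partial c g) (v(c := \<xi>, d := t))"] h by auto
  with \<xi> show thesis
    by (intro that[of \<xi> \<eta>]) simp_all
qed

text \<open>Schwarz's theorem. With step \<open>1 / Suc n\<close> the second difference is the
  squared step times either mixed derivative at points that converge to \<open>v\<close>; continuity
  of the second derivatives identifies the limits.\<close>

lemma partial_commute: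
  fixes g :: "('c \<Rightarrow> real) \<Rightarrow> real"
  assumes g: "C_k 2 g"
  shows "partial c (partial d g) = partial d (partial c g)"
proof (cases "c = d")
  case False
  show ?thesis
  proof
    fix v
    \<comment> \<open>The coordinate plane through \<open>v\<close> reduces continuity in the
      product topology to convergence of two real sequences.\<close>
    define m where "m = (\<lambda>z. v(c := fst z, d := snd z) :: 'c \<Rightarrow> real)"
    have mc: "continuous_on UNIV m"
    proof (rule continuous_on_coordinatewise_then_product)
      fix i
      consider "i = d" | "i \<noteq> d" "i = c" | "i \<noteq> d" "i \<noteq> c" by blast
      then show "continuous_on UNIV (\<lambda>z. m z i)"
        by cases (auto simp: m_def intro!: continuous_intros)
    qed
    have lim: "(\<lambda>n. partial x (partial y g) (m (\<xi> n, \<eta> n))) \<longlonglongrightarrow> partial x (partial y g) v"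
      if "\<And>n. v c < \<xi> n \<and> \<xi> n < v c + 1 / real (Suc n)"
        "\<And>n. v d < \<eta> n \<and> \<eta> n < v d + 1 / real (Suc n)" for \<xi> \<eta> x y
    proof -
      have *: "s \<longlonglongrightarrow> r" if "\<And>n. r < s n \<and> s n < r + 1 / real (Suc n)" for s :: "nat \<Rightarrow> real" and r
      proof (rule tendsto_sandwich[of "\<lambda>_. r" _ _ "\<lambda>n. r + 1 / real (Suc n)"])
        show "(\<lambda>n. r + 1 / real (Suc n)) \<longlonglongrightarrow> r"
          using tendsto_add[OF tendsto_const LIMSEQ_inverse_real_of_nat, of r]
          by (simp add: inverse_eq_divide)
      qed (use that less_imp_le in \<open>auto intro!: always_eventually\<close>)
      have "continuous_on UNIV (partial x (partial y g))"
        using g by (simp add: numeral_2_eq_2)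
      then have "continuous_on UNIV (partial x (partial y g) \<circ> m)"
        by (intro continuous_on_compose[OF mc]) (rule continuous_on_subset, auto)
      moreover have "(\<lambda>n. (\<xi> n, \<eta> n)) \<longlonglongrightarrow> (v c, v d)"
        using that by (intro tendsto_Pair *)
      ultimately have "(\<lambda>n. (partial x (partial y g) \<circ> m) (\<xi> n, \<eta> n))
          \<longlonglongrightarrow> (partial x (partial y g) \<circ> m) (v c, v d)"
        by (rule continuous_on_tendsto_compose) auto
      then show ?thesis
        by (simp add: m_def)
    qed
    let ?D = "\<lambda>h. g (v(c := v c + h, d := v d + h)) - g (v(c := v c, d := v d + h))
       - (g (v(c := v c + h, d := v d)) - g (v(c := v c, d := v d)))"
    have "\<exists>\<xi> \<eta>. v c < \<xi> \<and> \<xi> < v c + 1 / real (Suc n) \<and> v d < \<eta> \<and> \<eta> < v d + 1 / real (Suc n) \<and>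
        ?D (1 / real (Suc n)) = 1 / real (Suc n) * (1 / real (Suc n)) * partial d (partial c g) (m (\<xi>, \<eta>))" for n
      by (rule second_difference[OF g False, of "1 / real (Suc n)" "v c" "v d" v])
        (simp, unfold m_def, force)
    then obtain \<xi> \<eta> where 1: "\<And>n. v c < \<xi> n \<and> \<xi> n < v c + 1 / real (Suc n)"
        "\<And>n. v d < \<eta> n \<and> \<eta> n < v d + 1 / real (Suc n)"
      and D1: "\<And>n. ?D (1 / real (Suc n)) = 1 / real (Suc n) * (1 / real (Suc n)) * partial d (partial c g) (m (\<xi> n, \<eta> n))"
      by metis
    \<comment> \<open>As the two updates commute, \<open>second_difference\<close> with
      \<open>c\<close> and \<open>d\<close> exchanged describes the same number
      \<open>?D\<close>.\<close>
    have comm: "v(d := t, c := s) = v(c := s, d := t)" for s t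
      using False by (metis fun_upd_twist)
    have "\<exists>\<xi> \<eta>. v c < \<xi> \<and> \<xi> < v c + 1 / real (Suc n) \<and> v d < \<eta> \<and> \<eta> < v d + 1 / real (Suc n) \<and>
        ?D (1 / real (Suc n)) = 1 / real (Suc n) * (1 / real (Suc n)) * partial c (partial d g) (m (\<xi>, \<eta>))" for n
      by (rule second_difference[OF g False[symmetric], of "1 / real (Suc n)" "v d" "v c" v])
        (simp, unfold m_def comm, force)
    then obtain \<xi>' \<eta>' where 2: "\<And>n. v c < \<xi>' n \<and> \<xi>' n < v c + 1 / real (Suc n)"
        "\<And>n. v d < \<eta>' n \<and> \<eta>' n < v d + 1 / real (Suc n)"
      and D2: "\<And>n. ?D (1 / real (Suc n)) = 1 / real (Suc n) * (1 / real (Suc n)) * partial c (partial d g) (m (\<xi>' n, \<eta>' n))"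
      by metis
    have "(\<lambda>n. partial c (partial d g) (m (\<xi>' n, \<eta>' n))) = (\<lambda>n. partial d (partial c g) (m (\<xi> n, \<eta> n)))"
    proof
      fix n
      have "1 / real (Suc n) * (1 / real (Suc n)) \<noteq> 0" by simp
      then show "partial c (partial d g) (m (\<xi>' n, \<eta>' n)) = partial d (partial c g) (m (\<xi> n, \<eta> n))"
        using D1[of n] D2[of n] mult_left_cancel by metis
    qed
    with lim[OF 1, of d c] lim[OF 2, of c d]
    show "partial c (partial d g) v = partial d (partial c g) v"
      using LIMSEQ_unique by metis
  qed
qed simp

lemma pd_commute: "pd c (pd d g) = pd d (pd c g)"
  by transfer (rule partial_commute, simp add: smooth_def)

section \<open>Commutators of the total derivative with vertical and evolutionary fields\<close>

lemma Dx_uminus: "Dx (- g) = - Dx g"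
  using Dx_add[of g "- g"] by (simp add: eq_neg_iff_add_eq_0 add.commute)

lemma Dx_diff: "Dx (g - h) = Dx g - Dx h"
  using Dx_add[of g "- h"] by (simp add: Dx_uminus)

lemma Dx_neg_one_power_mult: "Dx ((-1) ^ n * g) = (-1) ^ n * Dx g"
  by (induction n) (simp_all add: Dx_uminus)

lemma Dx_pow_add: "(Dx ^^ n) (g + h) = (Dx ^^ n) g + (Dx ^^ n) h"
  by (induction n) (simp_all add: Dx_add)

lemma Dx_pow_0 [simp]: "(Dx ^^ n) 0 = 0"
  by (induction n) simp_all

lemma Dx_pow_uminus: "(Dx ^^ n) (- g) = - (Dx ^^ n) g"
  by (induction n) (simp_all add: Dx_uminus)

lemma pd_sum: "pd c (sum g I) = (\<Sum>i\<in>I. pd c (g i))"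
  by (induction I rule: infinite_finite_induct) (simp_all add: pd_add)

lemma pd_dcoord: "pd c (dcoord d) = (if c = d then 1 else 0)"
  by transfer (simp add: partial_coordinate fun_eq_iff)

lemma pd_dconst [simp]: "pd c (dconst r) = 0"
  by transfer simp

text \<open>One bound serves all components because \<open>'m\<close> is finite. It turns
  \<open>Sum_any\<close> into sums over \<open>k < N\<close>, whose index can be shifted.\<close>

lemma jet_order_bound:
  fixes g :: "'m::finite dfun"
  obtains N where "\<And>j k. k \<ge> N \<Longrightarrow> pd (Cu j k) g = 0"
proof -
  have "finite (\<Union>j::'m. {k. pd (Cu j k) g \<noteq> 0})"
    by (simp add: finite_pd_Cu)
  then obtain N where "\<forall>k\<in>(\<Union>j. {k. pd (Cu j k) g \<noteq> 0}). k < N"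
    using finite_nat_set_iff_bounded by blast
  then show thesis
    by (intro that[of N]) (force simp: not_less[symmetric])
qed

lemma Sum_any_lessThan:
  "(\<And>k. k \<ge> N \<Longrightarrow> g k = 0) \<Longrightarrow> Sum_any g = (\<Sum>k<N. g k)" for N :: nat
  by (rule Sum_any_finite_UNIV_supset) auto

text \<open>The extra term of this commutator arises when the derivative by \<open>Cu j k\<close>
  hits a coefficient of \<open>Dx\<close>: that coordinate is the coefficient of the derivative by
  \<open>Cu j (k - 1)\<close>, and for \<open>k = 0\<close> there is none.\<close>

lemma pd_Dx:
  "pd (Cu j k) (Dx g) = Dx (pd (Cu j k) g) + (case k of 0 \<Rightarrow> 0 | Suc k' \<Rightarrow> pd (Cu j k') g)"
proof -
  obtain N0 where N0: "\<And>i l. l \<ge> N0 \<Longrightarrow> pd (Cu i l) g = 0"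
    using jet_order_bound by blast
  \<comment> \<open>The term produced by the coefficient has index \<open>k - 1\<close> and has to
    lie in the range of summation, hence the maximum with \<open>k\<close>.\<close>
  define N where "N = max N0 k"
  have N: "pd (Cu i l) g = 0" if "l \<ge> N" for i l
    using that N0 by (simp add: N_def)
  have N': "pd (Cu i l) (pd (Cu j k) g) = 0" if "l \<ge> N" for i l
    using N[OF that, of i] by (subst pd_commute) simp
  have "Dx g = pd Cx g + (\<Sum>i\<in>UNIV. \<Sum>l<N. dcoord (Cu i (Suc l)) * pd (Cu i l) g)"
    by (simp add: Dx_def Sum_any_lessThan[of N] N)
  then have "pd (Cu j k) (Dx g) = pd (Cu j k) (pd Cx g) +
     ((\<Sum>i\<in>UNIV. \<Sum>l<N. (if i = j \<and> Suc l = k then pd (Cu i l) g else 0)) +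
      (\<Sum>i\<in>UNIV. \<Sum>l<N. dcoord (Cu i (Suc l)) * pd (Cu j k) (pd (Cu i l) g)))"
    by (auto simp: pd_add pd_sum pd_mult pd_dcoord sum.distrib[symmetric] intro!: sum.cong)
  also have "(\<Sum>i\<in>UNIV. \<Sum>l<N. (if i = j \<and> Suc l = k then pd (Cu i l) g else 0)) =
      (case k of 0 \<Rightarrow> 0 | Suc k' \<Rightarrow> pd (Cu j k') g)"
  proof (cases k)
    case (Suc k')
    then have "k' < N" by (simp add: N_def)
    have "(\<Sum>l<N. (if i = j \<and> Suc l = k then pd (Cu i l) g else 0)) =
        (if i = j then pd (Cu i k') g else 0)" for i
      using \<open>k' < N\<close> by (auto simp: Suc)
    then show ?thesis
      by (simp add: Suc)
  qed simp
  also have "pd (Cu j k) (pd Cx g) + ((case k of 0 \<Rightarrow> 0 | Suc k' \<Rightarrow> pd (Cu j k') g) +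
      (\<Sum>i\<in>UNIV. \<Sum>l<N. dcoord (Cu i (Suc l)) * pd (Cu j k) (pd (Cu i l) g))) =
      Dx (pd (Cu j k) g) + (case k of 0 \<Rightarrow> 0 | Suc k' \<Rightarrow> pd (Cu j k') g)"
    by (simp add: Dx_def Sum_any_lessThan[of N] N' pd_commute[of "Cu j k"] add_ac)
  finally show ?thesis .
qed

lemma Ev_add: "Ev \<phi> (g + h) = Ev \<phi> g + Ev \<phi> h"
  by (simp add: Ev_def Sum_any_pd_add sum.distrib)

lemma Ev_mult: "Ev \<phi> (g * h) = Ev \<phi> g * h + g * Ev \<phi> h"
  by (simp add: Ev_def Sum_any_pd_mult sum.distrib sum_distrib_left sum_distrib_right)

lemma Ev_uminus: "Ev \<phi> (- g) = - Ev \<phi> g"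
  using Ev_add[of \<phi> g "- g"] by (simp add: eq_neg_iff_add_eq_0 add.commute)

lemma Ev_diff: "Ev \<phi> (g - h) = Ev \<phi> g - Ev \<phi> h"
  using Ev_add[of \<phi> g "- h"] by (simp add: Ev_uminus)

lemma Ev_sum: "Ev \<phi> (sum g I) = (\<Sum>i\<in>I. Ev \<phi> (g i))"
  by (induction I rule: infinite_finite_induct) (simp_all add: Ev_add)

text \<open>After a shift of index, the extra terms of \<open>pd_Dx\<close> are those in which
  \<open>Dx\<close> hits the factor \<open>(Dx ^^ k) (\<phi> $ j)\<close>; with the other terms they
  make up the Leibniz rule.\<close>

lemma Ev_Dx: "Ev \<phi> (Dx g) = Dx (Ev \<phi> g)"
proof -
  obtain N where N: "\<And>j k. k \<ge> N \<Longrightarrow> pd (Cu j k) g = 0"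
    using jet_order_bound by blast
  \<comment> \<open>\<open>Dx\<close> raises the jet order by at most one.\<close>
  have N': "pd (Cu j k) (Dx g) = 0" if "k \<ge> Suc N" for j k
    using that by (auto simp: pd_Dx N split: nat.split)
  have "(\<Sum>k<Suc N. (Dx ^^ k) h * pd (Cu j k) (Dx g)) =
      (\<Sum>k<N. Dx ((Dx ^^ k) h * pd (Cu j k) g))" for j h
  proof -
    have "(\<Sum>k<Suc N. (Dx ^^ k) h * (case k of 0 \<Rightarrow> 0 | Suc k' \<Rightarrow> pd (Cu j k') g)) =
        (\<Sum>k<N. Dx ((Dx ^^ k) h) * pd (Cu j k) g)"
      by (subst sum.lessThan_Suc_shift) simp
    moreover have "(\<Sum>k<Suc N. (Dx ^^ k) h * Dx (pd (Cu j k) g)) =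
        (\<Sum>k<N. (Dx ^^ k) h * Dx (pd (Cu j k) g))"
      by (simp add: N)
    ultimately show ?thesis
      unfolding pd_Dx distrib_left sum.distrib Dx_mult by (simp add: add.commute)
  qed
  then show ?thesis
    by (simp add: Ev_def Sum_any_lessThan[of N] Sum_any_lessThan[of "Suc N"] N N' Dx_sum
        del: sum.lessThan_Suc)
qed

lemma Ev_Dx_pow: "Ev \<phi> ((Dx ^^ k) g) = (Dx ^^ k) (Ev \<phi> g)"
  by (induction k) (simp_all add: Ev_Dx)

lemma sapp_add_right: "sapp a (g + h) = sapp a g + sapp a h"
  by (simp add: sapp_def Dx_pow_add distrib_left sum.distrib)

lemma sapp_uminus_right: "sapp a (- g) = - sapp a g"
  by (simp add: sapp_def Dx_pow_uminus sum_negf)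

lemma sapp_uminus: "sapp (- a) g = - sapp a g"
  using sapp_add[of a "- a" g] by (simp add: eq_neg_iff_add_eq_0 add.commute)

lemma app_add: "app A (\<phi> + \<psi>) = app A \<phi> + app A \<psi>"
  by (simp add: app_def vec_eq_iff sapp_add_right sum.distrib)

lemma app_uminus: "app A (- \<phi>) = - app A \<phi>"
  by (simp add: app_def vec_eq_iff sapp_uminus_right sum_negf)

lemma app_diff: "app A (\<phi> - \<psi>) = app A \<phi> - app A \<psi>"
  using app_add[of A \<phi> "- \<psi>"] by (simp add: app_uminus)

lemma app_uminus_left: "app (- A) \<phi> = - app A \<phi>"
  by (simp add: app_def vec_eq_iff sapp_uminus sum_negf)

lemma Ev_sapp: "Ev \<phi> (sapp a g) = sapp (Poly_Mapping.map (Ev \<phi>) a) g + sapp a (Ev \<phi> g)"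
proof -
  have "Poly_Mapping.keys (Poly_Mapping.map (Ev \<phi>) a) \<subseteq> Poly_Mapping.keys a"
    by (auto simp: in_keys_iff map.rep_eq when_def)
  then have "sapp (Poly_Mapping.map (Ev \<phi>) a) g =
      (\<Sum>i\<in>Poly_Mapping.keys a. Ev \<phi> (Poly_Mapping.lookup a i) * (Dx ^^ i) g)"
    by (subst sapp_supset[of "Poly_Mapping.keys a"]) (simp_all add: map.rep_eq when_def in_keys_iff)
  then show ?thesis
    by (simp add: sapp_def Ev_sum Ev_mult Ev_Dx_pow sum.distrib)
qed

text \<open>The field acts either on the coefficients of \<open>A\<close>, which is
  \<open>lin_op\<close>, or on the argument, which it reaches because it commutes with
  \<open>Dx\<close>.\<close>

lemma Ev_vec_app: "Ev_vec \<chi>' (app A \<psi>) = app (lin_op A \<psi>) \<chi>' + app A (Ev_vec \<chi>' \<psi>)"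
  by (simp add: app_lin_op) (simp add: vec_eq_iff Ev_vec_def app_def Ev_op_def Ev_sum Ev_sapp sum.distrib)

lemma app_lin_app: "app (lin (app A \<psi>)) \<chi>' = app (lin_op A \<psi>) \<chi>' + app A (app (lin \<psi>) \<chi>')"
  by (simp add: app_lin Ev_vec_app)

section \<open>The pairing modulo total derivatives\<close>

lemma integration_by_parts: "\<exists>k. (Dx ^^ i) g * h - (-1) ^ i * (g * (Dx ^^ i) h) = Dx k"
proof (induction i arbitrary: g)
  case 0
  show ?case by (intro exI[of _ 0]) simp
next
  case (Suc i)
  \<comment> \<open>One derivative is moved at a time: the induction hypothesis is used for
    \<open>Dx g\<close> in place of \<open>g\<close>.\<close>
  from Suc[of "Dx g"] obtain k where "(Dx ^^ i) (Dx g) * h - (-1) ^ i * (Dx g * (Dx ^^ i) h) = Dx k"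
    by blast
  moreover have "Dx ((-1) ^ i * (g * (Dx ^^ i) h)) =
      (-1) ^ i * (Dx g * (Dx ^^ i) h) + (-1) ^ i * (g * (Dx ^^ Suc i) h)"
    by (simp add: Dx_neg_one_power_mult Dx_mult[of g] distrib_left)
  ultimately have "(Dx ^^ Suc i) g * h - (-1) ^ Suc i * (g * (Dx ^^ Suc i) h) =
      Dx (k + (-1) ^ i * (g * (Dx ^^ i) h))"
    unfolding Dx_add funpow_Suc_right o_apply by (simp add: algebra_simps funpow_swap1)
  then show ?case by blast
qed

lemma exact_sum: "(\<And>i. i \<in> I \<Longrightarrow> \<exists>k. g i = Dx k) \<Longrightarrow> \<exists>k. sum g I = Dx k"
proof -
  assume "\<And>i. i \<in> I \<Longrightarrow> \<exists>k. g i = Dx k"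
  then obtain k where "\<And>i. i \<in> I \<Longrightarrow> g i = Dx (k i)" by metis
  then have "sum g I = Dx (sum k I)"
    by (simp add: Dx_sum)
  then show ?thesis by blast
qed

lemma sapp_sadj_exact: "\<exists>k. sapp a g * h - g * sapp (sadj a) h = Dx k"
proof -
  have "sapp a g * h - g * sapp (sadj a) h = (\<Sum>i\<in>Poly_Mapping.keys a.
      (Dx ^^ i) g * (Poly_Mapping.lookup a i * h) -
      (-1) ^ i * (g * (Dx ^^ i) (Poly_Mapping.lookup a i * h)))"
    by (simp add: sapp_sadj) (simp add: sapp_def sum_distrib_left sum_distrib_right sum_subtractf mult_ac)
  then show ?thesis
    using exact_sum[OF integration_by_parts] by simp
qed

text \<open>Green's formula for matrices follows entrywise; the transposition in \<open>adj\<close>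
  is matched by exchanging the two summations.\<close>

lemma pairing_app_exact: "\<exists>k. pairing (app A \<psi>) \<phi> - pairing \<psi> (app (adj A) \<phi>) = Dx k"
proof -
  have "pairing \<psi> (app (adj A) \<phi>) = (\<Sum>j\<in>UNIV. \<Sum>l\<in>UNIV. \<psi> $ l * sapp (sadj (A $ j $ l)) (\<phi> $ j))"
    by (subst sum.swap) (simp add: pairing_def app_def adj_def sum_distrib_left)
  then have "pairing (app A \<psi>) \<phi> - pairing \<psi> (app (adj A) \<phi>) = (\<Sum>j\<in>UNIV. \<Sum>l\<in>UNIV.
      sapp (A $ j $ l) (\<psi> $ l) * \<phi> $ j - \<psi> $ l * sapp (sadj (A $ j $ l)) (\<phi> $ j))"
    by (simp add: sum_subtractf) (simp add: pairing_def app_def sum_distrib_right)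
  then show ?thesis
    using exact_sum[OF exact_sum[OF sapp_sadj_exact]] by simp
qed

section \<open>The Euler operator\<close>

lemma euler_lessThan:
  "(\<And>j k. k \<ge> N \<Longrightarrow> pd (Cu j k) g = 0) \<Longrightarrow>
    euler g $ j = (\<Sum>k<N. (-1) ^ k * (Dx ^^ k) (pd (Cu j k) g))"
  by (simp add: euler_def Sum_any_lessThan[of N])

text \<open>By \<open>pd_Dx\<close> the sum splits in two parts; the index shift in the second
  changes the sign \<open>(-1) ^ k\<close>, and the parts cancel.\<close>

lemma euler_Dx: "euler (Dx g) = 0"
proof -
  obtain N where N: "\<And>j k. k \<ge> N \<Longrightarrow> pd (Cu j k) g = 0"
    using jet_order_bound by blast
  have N': "pd (Cu j k) (Dx g) = 0" if "k \<ge> Suc N" for j k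
    using that by (auto simp: pd_Dx N split: nat.split)
  have "euler (Dx g) $ j = 0" for j
  proof -
    have "(\<Sum>k<Suc N. (-1) ^ k * (Dx ^^ k) (case k of 0 \<Rightarrow> 0 | Suc k' \<Rightarrow> pd (Cu j k') g)) =
        - (\<Sum>k<N. (-1) ^ k * (Dx ^^ k) (Dx (pd (Cu j k) g)))"
      by (subst sum.lessThan_Suc_shift) (simp add: sum_negf funpow_swap1)
    moreover have "euler (Dx g) $ j = (\<Sum>k<Suc N. (-1) ^ k * (Dx ^^ k) (pd (Cu j k) (Dx g)))"
      by (rule euler_lessThan) (rule N')
    ultimately show ?thesis
      unfolding pd_Dx Dx_pow_add distrib_left sum.distrib
      by (simp add: N del: sum.lessThan_Suc) (simp add: N)
  qed
  then show ?thesis by (simp add: vec_eq_iff)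
qed

lemma euler_add: "euler (g + h) = euler g + euler h"
proof -
  obtain N1 where N1: "\<And>j k. k \<ge> N1 \<Longrightarrow> pd (Cu j k) g = 0"
    using jet_order_bound by blast
  obtain N2 where N2: "\<And>j k. k \<ge> N2 \<Longrightarrow> pd (Cu j k) h = 0"
    using jet_order_bound by blast
  show ?thesis
    by (simp add: vec_eq_iff euler_lessThan[of "max N1 N2"] N1 N2 pd_add Dx_pow_add distrib_left sum.distrib)
qed

lemma euler_0 [simp]: "euler 0 = 0"
  using euler_Dx[of 0] by simp

lemma euler_uminus: "euler (- g) = - euler g"
  using euler_add[of g "- g"] by (simp add: eq_neg_iff_add_eq_0 add.commute)

lemma euler_diff: "euler (g - h) = euler g - euler h"
  using euler_add[of g "- h"] by (simp add: euler_uminus)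

lemma euler_sum: "euler (sum g I) = (\<Sum>i\<in>I. euler (g i))"
  by (induction I rule: infinite_finite_induct) (simp_all add: euler_add)

lemma sapp_sadj_slin:
  assumes "\<And>j k. k \<ge> N \<Longrightarrow> pd (Cu j k) g = 0"
  shows "sapp (sadj (slin g j)) h = (\<Sum>k<N. (-1) ^ k * (Dx ^^ k) (pd (Cu j k) g * h))"
  unfolding sapp_sadj
  by (rule sum.mono_neutral_cong_left)
    (use assms in \<open>auto simp: in_keys_iff slin.rep_eq intro: leI not_le_imp_less\<close>)

text \<open>The jet derivatives split by the product rule, so each factor becomes the argument of
  the adjoint linearization of the other.\<close>

lemma euler_mult: "euler (g * h) $ j = sapp (sadj (slin g j)) h + sapp (sadj (slin h j)) g"
proof -
  obtain N1 where N1: "\<And>j k. k \<ge> N1 \<Longrightarrow> pd (Cu j k) g = 0"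
    using jet_order_bound by blast
  obtain N2 where N2: "\<And>j k. k \<ge> N2 \<Longrightarrow> pd (Cu j k) h = 0"
    using jet_order_bound by blast
  show ?thesis
    by (simp add: euler_lessThan[of "max N1 N2"] sapp_sadj_slin[of "max N1 N2"] N1 N2 pd_mult
        Dx_pow_add distrib_left sum.distrib) (simp add: mult.commute)
qed

lemma euler_pairing: "euler (pairing \<phi> \<psi>) = app (adj (lin \<phi>)) \<psi> + app (adj (lin \<psi>)) \<phi>"
  by (simp add: vec_eq_iff pairing_def euler_sum euler_mult app_def adj_def lin_def sum.distrib)

text \<open>The divided powers of \<open>x\<close> separate the coefficients of a C-differential operator.\<close>

definition xdiv :: "nat \<Rightarrow> 'm::finite dfun"
  where "xdiv n = dconst (1 / fact n) * dcoord Cx ^ n"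

lemma pd_Cu_xdiv [simp]: "pd (Cu j k) (xdiv n) = 0"
proof -
  have "pd (Cu j k) (dcoord Cx ^ n) = 0"
    by (induction n) (simp_all add: pd_mult pd_dcoord)
  then show ?thesis by (simp add: xdiv_def pd_mult)
qed

lemma dconst_mult: "dconst (r * s) = dconst r * dconst s"
  by transfer simp

lemma dconst_of_nat: "(dconst (of_nat n) :: 'm dfun) = of_nat n"
proof (induction n)
  case 0
  show ?case by (simp, transfer, simp)
next
  case (Suc n)
  have "(dconst (of_nat (Suc n)) :: 'm dfun) = 1 + dconst (of_nat n)"
    by transfer simp
  then show ?case using Suc by (simp only: of_nat_Suc)
qed

lemma xdiv_0: "xdiv 0 = 1"
  unfolding xdiv_def using dconst_of_nat[of 1] by simp

lemma pd_Cx_power: "pd Cx (dcoord Cx ^ Suc n :: 'm dfun) = of_nat (Suc n) * dcoord Cx ^ n"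
proof (induction n)
  case (Suc n)
  have "pd Cx (dcoord Cx * dcoord Cx ^ Suc n :: 'm dfun) =
      dcoord Cx ^ Suc n + dcoord Cx * (of_nat (Suc n) * dcoord Cx ^ n)"
    by (simp only: pd_mult[of Cx "dcoord Cx"] Suc pd_dcoord) simp
  then show ?case
    by (simp add: algebra_simps)
qed (simp add: pd_dcoord)

lemma Dx_xdiv_Suc: "Dx (xdiv (Suc n)) = xdiv n"
proof -
  have "dconst (1 / fact (Suc n)) * of_nat (Suc n) = (dconst (1 / fact n) :: 'a dfun)"
    unfolding dconst_of_nat[symmetric] dconst_mult[symmetric]
    by (rule arg_cong[of _ _ dconst]) (simp add: field_simps del: of_nat_Suc)
  then have "pd Cx (xdiv (Suc n)) = (xdiv n :: 'a dfun)"
    unfolding xdiv_def pd_mult pd_Cx_power pd_dconst mult.assoc[symmetric] by simp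
  then show ?thesis by (simp add: Dx_def)
qed

lemma Dx_pow_xdiv: "(Dx ^^ i) (xdiv n) = (if i \<le> n then xdiv (n - i) else 0)"
proof (induction i arbitrary: n)
  case (Suc i)
  show ?case
  proof (cases n)
    case 0
    then show ?thesis
      unfolding funpow_Suc_right o_apply by (simp add: xdiv_0)
  next
    case (Suc n')
    then show ?thesis
      unfolding funpow_Suc_right o_apply by (simp add: Dx_xdiv_Suc Suc.IH)
  qed
qed simp

text \<open>Induction on the order. Applied to \<open>xdiv n\<close>, the terms with
  \<open>i > n\<close> vanish because \<open>Dx ^^ i\<close> annihilates it, those with
  \<open>i < n\<close> by induction, and \<open>i = n\<close> leaves \<open>a n\<close>, as
  \<open>xdiv 0 = 1\<close>.\<close>

lemma operator_coeffs_zero: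
  assumes "finite I" and "\<And>n. (\<Sum>i\<in>I. a i * (Dx ^^ i) (xdiv n)) = 0" and "i \<in> I"
  shows "a i = 0"
  using \<open>i \<in> I\<close>
proof (induction i rule: less_induct)
  case (less n)
  have "a i * (Dx ^^ i) (xdiv n) = (if i = n then a n else 0)" if "i \<in> I" for i
    using that less by (cases i n rule: linorder_cases) (simp_all add: Dx_pow_xdiv xdiv_0)
  then have "(\<Sum>i\<in>I. a i * (Dx ^^ i) (xdiv n)) = (\<Sum>i\<in>I. if i = n then a n else 0)"
    by (rule sum.cong[OF refl])
  then show ?case
    using assms(1,2) less.prems by simp
qed

lemma euler_nondegenerate:
  assumes "\<And>h. euler (h * g) = 0"
  shows "g = 0"
proof -
  fix j :: 'a
  \<comment> \<open>The linearization of \<open>xdiv n\<close> vanishes, so of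
    \<open>euler_mult\<close> only the adjoint linearization of \<open>g\<close>, applied to
    \<open>xdiv n\<close>, survives. Hence this operator annihilates everything.\<close>
  have "sapp (sadj (slin g j)) (xdiv n) = 0" for n
  proof -
    have "slin (xdiv n) j = 0"
      by (rule poly_mapping_eqI) (simp add: slin.rep_eq)
    then have "euler (xdiv n * g) $ j = sapp (sadj (slin g j)) (xdiv n)"
      by (simp add: euler_mult sapp_sadj)
    then show ?thesis using assms by simp
  qed
  then have "Poly_Mapping.lookup (sadj (slin g j)) i = 0" if "i \<in> Poly_Mapping.keys (sadj (slin g j))" for i
    using operator_coeffs_zero[OF finite_keys[of "sadj (slin g j)"], of "Poly_Mapping.lookup (sadj (slin g j))"] that
    by (simp add: sapp_def)
  then have "sapp (sadj (slin g j)) h = 0" for h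
    by (simp add: sapp_def)
  \<comment> \<open>The linearization of the coordinate \<open>Cu j 0\<close> in direction
    \<open>j\<close> is the identity, so this choice of \<open>h\<close> returns \<open>g\<close>
    itself.\<close>
  moreover have "sapp (sadj (slin (dcoord (Cu j 0)) j)) g = g"
    by (subst sapp_sadj_slin[of 1]) (simp_all add: pd_dcoord)
  ultimately have "euler (dcoord (Cu j 0) * g) $ j = g"
    by (simp add: euler_mult)
  then show ?thesis using assms by simp
qed

text \<open>Test sections with one non-zero component reduce the claim to functions. Below,
  identities between adjoints are verified by pairing with an arbitrary section, without computing
  coefficients.\<close>

lemma pairing_nondegenerate:
  assumes "\<And>\<phi>. euler (pairing \<phi> \<psi>) = 0"
  shows "\<psi> = 0"
proof -
  have "\<psi> $ j = 0" for j
  proof (rule euler_nondegenerate)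
    fix h
    have "(if i = j then h else 0) * \<psi> $ i = (if i = j then h * \<psi> $ j else 0)" for i
      by simp
    then have "pairing (\<chi> i. if i = j then h else 0) \<psi> = h * \<psi> $ j"
      by (simp add: pairing_def)
    then show "euler (h * \<psi> $ j) = 0"
      using assms by metis
  qed
  then show ?thesis by (simp add: vec_eq_iff)
qed

section \<open>Adjunction under the pairing, and its linearization\<close>

lemma pairing_commute: "pairing \<phi> \<psi> = pairing \<psi> \<phi>"
  by (simp add: pairing_def mult.commute)

lemma pairing_add_left: "pairing (\<phi> + \<phi>') \<psi> = pairing \<phi> \<psi> + pairing \<phi>' \<psi>"
  by (simp add: pairing_def distrib_right sum.distrib)

lemma pairing_diff_left: "pairing (\<phi> - \<phi>') \<psi> = pairing \<phi> \<psi> - pairing \<phi>' \<psi>"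
  by (simp add: pairing_def left_diff_distrib sum_subtractf)

lemma pairing_add_right: "pairing \<phi> (\<psi> + \<psi>') = pairing \<phi> \<psi> + pairing \<phi> \<psi>'"
  by (simp add: pairing_def distrib_left sum.distrib)

lemma pairing_diff_right: "pairing \<phi> (\<psi> - \<psi>') = pairing \<phi> \<psi> - pairing \<phi> \<psi>'"
  by (simp add: pairing_def right_diff_distrib sum_subtractf)

lemma pairing_uminus_right: "pairing \<phi> (- \<psi>) = - pairing \<phi> \<psi>"
  by (simp add: pairing_def sum_negf)

lemma Ev_pairing: "Ev \<chi>' (pairing \<phi> \<psi>) = pairing (Ev_vec \<chi>' \<phi>) \<psi> + pairing \<phi> (Ev_vec \<chi>' \<psi>)"
  unfolding pairing_def Ev_sum Ev_mult sum.distrib by (simp add: Ev_vec_def)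

lemma euler_pairing_app: "euler (pairing (app A \<psi>) \<phi>) = euler (pairing \<psi> (app (adj A) \<phi>))"
  using pairing_app_exact[of A \<psi> \<phi>] by (metis euler_Dx euler_diff right_minus_eq)

text \<open>Green's formula is differentiated along \<open>\<chi>'\<close>. The remainder stays
  exact because \<open>Ev\<close> commutes with \<open>Dx\<close>, and the terms in which an
  argument is differentiated cancel by Green's formula itself.\<close>

lemma euler_pairing_lin_op:
  "euler (pairing (app (lin_op A \<psi>\<^sub>1) \<chi>') \<psi>\<^sub>2) = euler (pairing \<psi>\<^sub>1 (app (lin_op (adj A) \<psi>\<^sub>2) \<chi>'))"
proof -
  obtain k where k: "pairing (app A \<psi>\<^sub>1) \<psi>\<^sub>2 - pairing \<psi>\<^sub>1 (app (adj A) \<psi>\<^sub>2) = Dx k"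
    using pairing_app_exact by blast
  have "euler (Ev \<chi>' (pairing (app A \<psi>\<^sub>1) \<psi>\<^sub>2) - Ev \<chi>' (pairing \<psi>\<^sub>1 (app (adj A) \<psi>\<^sub>2))) = 0"
    unfolding Ev_diff[symmetric] k by (simp add: Ev_Dx euler_Dx)
  then show ?thesis
    by (simp add: Ev_pairing Ev_vec_app pairing_add_left pairing_add_right euler_add euler_diff
        euler_pairing_app)
qed

section \<open>Operator identities\<close>

text \<open>By \<open>euler_pairing_lin_op\<close>, the derivative of a skew-adjoint operator along
  any section is again skew-adjoint; moving that section out of the pairing exchanges the two
  arguments.\<close>

lemma app_adj_lin_op_skew:
  assumes "adj A = - A"
  shows "app (adj (lin_op A \<psi>\<^sub>1)) \<psi>\<^sub>2 = - app (adj (lin_op A \<psi>\<^sub>2)) \<psi>\<^sub>1"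
proof -
  \<comment> \<open>The sign is read off from the Leibniz rule, which avoids the coefficients in
    \<open>lin_op\<close>.\<close>
  have neg: "app (lin_op (- A) \<psi>) \<phi> = - app (lin_op A \<psi>) \<phi>" for \<psi> \<phi>
    using Ev_vec_app[of \<phi> "- A" \<psi>] Ev_vec_app[of \<phi> A \<psi>]
    by (simp add: app_uminus_left Ev_vec_def vec_eq_iff Ev_uminus)
  have "app (adj (lin_op A \<psi>\<^sub>1)) \<psi>\<^sub>2 + app (adj (lin_op A \<psi>\<^sub>2)) \<psi>\<^sub>1 = 0"
  proof (rule pairing_nondegenerate)
    fix \<phi>
    have "euler (pairing (app (lin_op A \<psi>\<^sub>1) \<phi>) \<psi>\<^sub>2) = - euler (pairing (app (lin_op A \<psi>\<^sub>2) \<phi>) \<psi>\<^sub>1)"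
      unfolding euler_pairing_lin_op[of A \<psi>\<^sub>1] assms neg pairing_uminus_right euler_uminus
      by (simp add: pairing_commute)
    then show "euler (pairing \<phi> (app (adj (lin_op A \<psi>\<^sub>1)) \<psi>\<^sub>2 + app (adj (lin_op A \<psi>\<^sub>2)) \<psi>\<^sub>1)) = 0"
      by (simp add: pairing_add_right euler_add euler_pairing_app[symmetric])
  qed
  then show ?thesis
    by (simp add: eq_neg_iff_add_eq_0)
qed

text \<open>The adjoint of \<open>app_lin_app\<close>; adjunction reverses the composition.\<close>

lemma app_adj_lin_app:
  "app (adj (lin (app A \<psi>))) \<chi>' = app (adj (lin_op A \<psi>)) \<chi>' + app (adj (lin \<psi>)) (app (adj A) \<chi>')"
proof -
  have "app (adj (lin (app A \<psi>))) \<chi>' - (app (adj (lin_op A \<psi>)) \<chi>' + app (adj (lin \<psi>)) (app (adj A) \<chi>')) = 0"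
    by (rule pairing_nondegenerate)
      (simp add: pairing_add_right pairing_diff_right euler_add euler_diff
        euler_pairing_app[symmetric] app_lin_app pairing_add_left)
  then show ?thesis by simp
qed

text \<open>The commutation relation is differentiated along \<open>\<phi>\<close> and paired with
  \<open>\<psi>\<^sub>2\<close>; all terms are then moved so that they are paired with
  \<open>\<phi>\<close>.\<close>

lemma app_adj_commute:
  assumes "\<And>\<psi>. app R (app A \<psi>) = app A (app (adj R) \<psi>)" and "adj A = - A"
  shows "app (adj (lin_op A \<psi>\<^sub>1)) (app (adj R) \<psi>\<^sub>2) + app (adj (lin_op (adj R) \<psi>\<^sub>2)) (app A \<psi>\<^sub>1)
    + app (adj (lin_op A \<psi>\<^sub>2)) (app (adj R) \<psi>\<^sub>1) + app (adj (lin_op (adj R) \<psi>\<^sub>1)) (app A \<psi>\<^sub>2) = 0"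
proof (rule pairing_nondegenerate)
  fix \<phi>
  \<comment> \<open>The terms that differentiate \<open>\<psi>\<^sub>1\<close> cancel by the
    commutation relation.\<close>
  have "app (lin_op R (app A \<psi>\<^sub>1)) \<phi> + app R (app (lin_op A \<psi>\<^sub>1) \<phi>) =
      app (lin_op A (app (adj R) \<psi>\<^sub>1)) \<phi> + app A (app (lin_op (adj R) \<psi>\<^sub>1) \<phi>)"
    using Ev_vec_app[of \<phi> R "app A \<psi>\<^sub>1"] Ev_vec_app[of \<phi> A "app (adj R) \<psi>\<^sub>1"]
    by (simp add: assms Ev_vec_app app_add)
  then have "euler (pairing (app (lin_op R (app A \<psi>\<^sub>1)) \<phi> + app R (app (lin_op A \<psi>\<^sub>1) \<phi>)) \<psi>\<^sub>2) =
      euler (pairing (app (lin_op A (app (adj R) \<psi>\<^sub>1)) \<phi> + app A (app (lin_op (adj R) \<psi>\<^sub>1) \<phi>)) \<psi>\<^sub>2)"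
    by simp
  then have "euler (pairing (app (lin_op (adj R) \<psi>\<^sub>2) \<phi>) (app A \<psi>\<^sub>1)) +
        euler (pairing (app (lin_op A \<psi>\<^sub>1) \<phi>) (app (adj R) \<psi>\<^sub>2)) =
      euler (pairing \<phi> (app (adj (lin_op A (app (adj R) \<psi>\<^sub>1))) \<psi>\<^sub>2)) -
        euler (pairing (app (lin_op (adj R) \<psi>\<^sub>1) \<phi>) (app A \<psi>\<^sub>2))"
    by (simp add: pairing_add_left euler_add euler_pairing_lin_op[of R] euler_pairing_app[of R]
        euler_pairing_app[of A] euler_pairing_app[of "lin_op A (app (adj R) \<psi>\<^sub>1)"] assms(2)
        app_uminus_left pairing_uminus_right euler_uminus pairing_commute[of "app A \<psi>\<^sub>1"])
  \<comment> \<open>Skewness turns the one term linearized at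
    \<open>app (adj R) \<psi>\<^sub>1\<close> into a term linearized at
    \<open>\<psi>\<^sub>2\<close>.\<close>
  moreover have "app (adj (lin_op A (app (adj R) \<psi>\<^sub>1))) \<psi>\<^sub>2 =
      - app (adj (lin_op A \<psi>\<^sub>2)) (app (adj R) \<psi>\<^sub>1)"
    using assms(2) by (rule app_adj_lin_op_skew)
  ultimately show "euler (pairing \<phi> (app (adj (lin_op A \<psi>\<^sub>1)) (app (adj R) \<psi>\<^sub>2)
      + app (adj (lin_op (adj R) \<psi>\<^sub>2)) (app A \<psi>\<^sub>1)
      + app (adj (lin_op A \<psi>\<^sub>2)) (app (adj R) \<psi>\<^sub>1) + app (adj (lin_op (adj R) \<psi>\<^sub>1)) (app A \<psi>\<^sub>2))) = 0"
    by (simp add: pairing_add_right euler_add euler_pairing_app[symmetric] pairing_uminus_right euler_uminus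
        eq_neg_iff_add_eq_0 algebra_simps)
qed

text \<open>When \<open>Lie\<close> and \<open>euler\<close> are expanded, all terms that linearize
  \<open>\<psi>\<^sub>1\<close> or \<open>\<psi>\<^sub>2\<close> cancel; what is left differentiates
  only the coefficients of \<open>A\<close> and \<open>adj R\<close>.\<close>

lemma compatible_lin_op:
  assumes "compatible A R" and RA: "\<And>\<psi>. app R (app A \<psi>) = app A (app (adj R) \<psi>)"
    and skew: "adj A = - A"
  shows "- app (lin_op (adj R) \<psi>\<^sub>1) (app A \<psi>\<^sub>2) + app (lin_op (adj R) \<psi>\<^sub>2) (app A \<psi>\<^sub>1)
    + app (adj (lin_op A \<psi>\<^sub>1)) (app (adj R) \<psi>\<^sub>2) + app (adj (lin_op (adj R) \<psi>\<^sub>1)) (app A \<psi>\<^sub>2)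
    - app (adj R) (app (adj (lin_op A \<psi>\<^sub>1)) \<psi>\<^sub>2) = 0"
proof -
  have Lie: "Lie (app A \<psi>) \<phi> = Ev_vec (app A \<psi>) \<phi> + app (adj (lin_op A \<psi>)) \<phi>
      - app (adj (lin \<psi>)) (app A \<phi>)" for \<psi> \<phi>
    by (simp add: Lie_def app_adj_lin_app skew app_uminus_left app_uminus)
  \<comment> \<open>Involutivity of the adjoint is seen from the pairing rather than from the normal
    form in \<open>sadj\<close>.\<close>
  have adjR: "app (adj (adj R)) \<phi> = app R \<phi>" for \<phi>
  proof -
    have "app (adj (adj R)) \<phi> - app R \<phi> = 0"
    proof (rule pairing_nondegenerate)
      fix \<psi>
      show "euler (pairing \<psi> (app (adj (adj R)) \<phi> - app R \<phi>)) = 0"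
        by (simp add: pairing_diff_right euler_diff euler_pairing_app[symmetric])
          (simp add: pairing_commute[of \<psi>] pairing_commute[of _ \<phi>] euler_pairing_app)
    qed
    then show ?thesis by simp
  qed
  have eul1: "euler (pairing \<psi> (app A \<phi>)) = app (adj (lin \<psi>)) (app A \<phi>)
      + app (adj (lin_op A \<phi>)) \<psi> - app (adj (lin \<phi>)) (app A \<psi>)" for \<psi> \<phi>
    by (simp add: euler_pairing app_adj_lin_app skew app_uminus_left app_uminus)
  have eul2: "euler (pairing \<psi> (app A (app (adj R) \<phi>))) = app (adj (lin \<psi>)) (app A (app (adj R) \<phi>))
      + app (adj (lin_op A (app (adj R) \<phi>))) \<psi> - app (adj (lin_op (adj R) \<phi>)) (app A \<psi>)
      - app (adj (lin \<phi>)) (app A (app (adj R) \<psi>))" for \<psi> \<phi>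
    by (simp add: eul1 app_adj_lin_app adjR RA)
  have "Lie (app A \<psi>\<^sub>1) (app (adj R) \<psi>\<^sub>2) - Lie (app A \<psi>\<^sub>2) (app (adj R) \<psi>\<^sub>1)
     + app (adj R) (Lie (app A \<psi>\<^sub>2) \<psi>\<^sub>1) - app (adj R) (Lie (app A \<psi>\<^sub>1) \<psi>\<^sub>2)
     + euler (pairing \<psi>\<^sub>1 (app A (app (adj R) \<psi>\<^sub>2)))
     - app (adj R) (euler (pairing \<psi>\<^sub>1 (app A \<psi>\<^sub>2))) = 0"
    using assms(1) unfolding compatible_def by blast
  \<comment> \<open>By skewness the \<open>euler\<close> term linearized at
    \<open>app (adj R) \<psi>\<^sub>2\<close> cancels a term of \<open>Lie\<close>;
    \<open>app_adj_commute\<close> then trades the adjoints at \<open>\<psi>\<^sub>2\<close> for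
    those at \<open>\<psi>\<^sub>1\<close>.\<close>
  then show ?thesis
    using app_adj_commute[OF RA skew, of \<psi>\<^sub>1 \<psi>\<^sub>2] app_adj_lin_op_skew[OF skew, of "app (adj R) \<psi>\<^sub>2" \<psi>\<^sub>1]
    unfolding eul2 unfolding eul1 Lie Ev_vec_app app_add app_diff
    by (simp add: algebra_simps)
qed

text \<open>This is \<open>compatible_lin_op\<close> transposed: one of its two sections becomes the
  test section, and each of the five terms is moved onto \<open>\<phi>\<close> by
  adjunction.\<close>

lemma lin_op_mixed_identity:
  assumes "compatible A R" and RA: "\<And>\<psi>. app R (app A \<psi>) = app A (app (adj R) \<psi>)"
    and skew: "adj A = - A"
  shows "app (lin_op R \<phi>) (app A \<psi>) - app (lin_op A \<psi>) (app R \<phi>)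
    + app A (app (adj (lin_op R \<phi>)) \<psi> - app (lin_op (adj R) \<psi>) \<phi>)
    + app R (app (lin_op A \<psi>) \<phi>) = 0" (is "?X = 0")
proof (rule pairing_nondegenerate)
  fix \<psi>\<^sub>2
  let ?E = "\<lambda>a b. euler (pairing a b)"
  have A: "?E (app A a) b = - ?E a (app A b)" for a b
    by (simp add: euler_pairing_app skew app_uminus_left pairing_uminus_right euler_uminus)
  have "?E (app (lin_op R \<phi>) (app A \<psi>)) \<psi>\<^sub>2 = ?E \<phi> (app (lin_op (adj R) \<psi>\<^sub>2) (app A \<psi>))"
    by (rule euler_pairing_lin_op)
  moreover have "?E (app (lin_op A \<psi>) (app R \<phi>)) \<psi>\<^sub>2 = ?E \<phi> (app (adj R) (app (adj (lin_op A \<psi>)) \<psi>\<^sub>2))"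
    by (simp add: euler_pairing_app)
  moreover have "?E (app A (app (adj (lin_op R \<phi>)) \<psi>)) \<psi>\<^sub>2 = - ?E \<phi> (app (lin_op (adj R) \<psi>) (app A \<psi>\<^sub>2))"
    unfolding A pairing_commute[of "app (adj _) _"] euler_pairing_app[symmetric] euler_pairing_lin_op[symmetric]
    by simp
  moreover have "?E (app A (app (lin_op (adj R) \<psi>) \<phi>)) \<psi>\<^sub>2 = - ?E \<phi> (app (adj (lin_op (adj R) \<psi>)) (app A \<psi>\<^sub>2))"
    by (simp add: A euler_pairing_app[of "lin_op (adj R) \<psi>"])
  moreover have "?E (app R (app (lin_op A \<psi>) \<phi>)) \<psi>\<^sub>2 = ?E \<phi> (app (adj (lin_op A \<psi>)) (app (adj R) \<psi>\<^sub>2))"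
    by (simp add: euler_pairing_app)
  ultimately have "?E ?X \<psi>\<^sub>2 = ?E \<phi> (- app (lin_op (adj R) \<psi>) (app A \<psi>\<^sub>2) + app (lin_op (adj R) \<psi>\<^sub>2) (app A \<psi>)
    + app (adj (lin_op A \<psi>)) (app (adj R) \<psi>\<^sub>2) + app (adj (lin_op (adj R) \<psi>)) (app A \<psi>\<^sub>2)
    - app (adj R) (app (adj (lin_op A \<psi>)) \<psi>\<^sub>2))"
    unfolding app_diff pairing_add_left pairing_diff_left pairing_add_right pairing_diff_right
      pairing_uminus_right euler_add euler_diff euler_uminus by (simp add: algebra_simps)
  also have "\<dots> = 0"
    unfolding compatible_lin_op[OF assms] by (simp add: pairing_def)
  finally show "?E \<psi>\<^sub>2 ?X = 0"
    by (simp add: pairing_commute)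
qed

section \<open>The Hamiltonian and Nijenhuis conditions in terms of linearized operators\<close>

lemma double_eq_0_dfun: "g + g = (0 :: 'm dfun) \<Longrightarrow> g = 0"
  by transfer (auto simp: fun_eq_iff)

lemma double_eq_0_vfun: "\<phi> + \<phi> = (0 :: 'm::finite vfun) \<Longrightarrow> \<phi> = 0"
  by (simp add: vec_eq_iff double_eq_0_dfun)

lemma hamiltonian_lin_op:
  assumes "hamiltonian A"
  shows "app (lin_op A \<psi>\<^sub>1) (app A \<psi>\<^sub>2) - app (lin_op A \<psi>\<^sub>2) (app A \<psi>\<^sub>1)
    + app A (app (adj (lin_op A \<psi>\<^sub>1)) \<psi>\<^sub>2) = 0" (is "?X = 0")
proof -
  have "schouten A A \<psi>\<^sub>1 \<psi>\<^sub>2 = - (?X + ?X)"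
    by (simp add: schouten_def)
  then have "- (?X + ?X) = 0"
    using assms unfolding hamiltonian_def by metis
  then show ?thesis
    unfolding neg_equal_0_iff_equal by (rule double_eq_0_vfun)
qed

text \<open>In the Jacobi brackets, expanded by the Leibniz rule, every term that differentiates a
  section cancels; the bracket of \<open>R\<close> with itself counts the rest twice.\<close>

lemma nijenhuis_lin_op:
  assumes "nijenhuis R"
  shows "app (lin_op R \<phi>\<^sub>1) (app R \<phi>\<^sub>2) - app (lin_op R \<phi>\<^sub>2) (app R \<phi>\<^sub>1)
    - app R (app (lin_op R \<phi>\<^sub>1) \<phi>\<^sub>2 - app (lin_op R \<phi>\<^sub>2) \<phi>\<^sub>1) = 0" (is "?X = 0")
proof -
  have "FN_bracket R R \<phi>\<^sub>1 \<phi>\<^sub>2 = - (?X + ?X)"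
    unfolding FN_bracket_def jacobi_def Ev_vec_app app_add app_diff by simp
  then have "- (?X + ?X) = 0"
    using assms unfolding nijenhuis_def by metis
  then show ?thesis
    unfolding neg_equal_0_iff_equal by (rule double_eq_0_vfun)
qed

section \<open>Evaluation of Grassmann elements\<close>

text \<open>A linear functional given by its values on monomials; the antisymmetry of the odd
  variables is put into the choice of \<open>m\<close>.\<close>

definition ev :: "('s \<Rightarrow> 'r::comm_ring_1) \<Rightarrow> ('s \<Rightarrow>\<^sub>0 'r) \<Rightarrow> 'r"
  where "ev m a = (\<Sum>S\<in>Poly_Mapping.keys a. Poly_Mapping.lookup a S * m S)"

lemma ev_superset:
  assumes "finite I" "Poly_Mapping.keys a \<subseteq> I"
  shows "ev m a = (\<Sum>S\<in>I. Poly_Mapping.lookup a S * m S)"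
  unfolding ev_def using assms by (intro sum.mono_neutral_left) (auto simp: in_keys_iff)

lemma ev_0 [simp]: "ev m 0 = 0"
  by (simp add: ev_def)

lemma ev_single: "ev m (Poly_Mapping.single S c) = c * m S"
  by (simp add: ev_def)

lemma ev_add: "ev m (a + b) = ev m a + ev m b"
proof -
  let ?I = "Poly_Mapping.keys a \<union> Poly_Mapping.keys b"
  have "Poly_Mapping.keys (a + b) \<subseteq> ?I"
    by (rule Poly_Mapping.keys_add)
  then show ?thesis
    by (simp add: ev_superset[of ?I] lookup_add distrib_right sum.distrib)
qed

lemma ev_uminus: "ev m (- a) = - ev m a"
  using ev_add[of m a "- a"] by (simp add: eq_neg_iff_add_eq_0 add.commute)

lemma ev_diff: "ev m (a - b) = ev m a - ev m b"
  using ev_add[of m a "- b"] by (simp add: ev_uminus)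

lemma ev_sum: "ev m (sum g I) = (\<Sum>i\<in>I. ev m (g i))"
  by (induction I rule: infinite_finite_induct) (simp_all add: ev_add)

lemma lookup_gscale: "Poly_Mapping.lookup (gscale c a) S = c * Poly_Mapping.lookup a S"
  by (simp add: gscale_def map.rep_eq when_def)

lemma ev_gscale: "ev m (gscale c a) = c * ev m a"
proof -
  have "Poly_Mapping.keys (gscale c a) \<subseteq> Poly_Mapping.keys a"
    by (auto simp: in_keys_iff lookup_gscale)
  then show ?thesis
    by (simp add: ev_superset[of "Poly_Mapping.keys a"] lookup_gscale sum_distrib_left mult.assoc)
qed

lemma koszul_singleton: "koszul {|s|} {|t|} =
    (if s = t then 0 else if to_nat t < to_nat s then -1 else 1 :: 'r::comm_ring_1)"
proof -
  have "{(a, b). a |\<in>| {|s|} \<and> b |\<in>| {|t|} \<and> to_nat b < to_nat a} =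
      (if to_nat t < to_nat s then {(s, t)} else {})"
    by auto
  then show ?thesis
    by (simp add: koszul_def)
qed

lemma koszul_singleton_swap: "koszul {|t|} {|s|} = - (koszul {|s|} {|t|} :: 'r::comm_ring_1)"
proof (cases "s = t")
  case False
  then have "to_nat s \<noteq> to_nat t"
    by simp
  then show ?thesis
    by (auto simp: koszul_singleton)
qed (simp add: koszul_singleton)

lemma koszul_singleton_square:
  "s \<noteq> t \<Longrightarrow> koszul {|s|} {|t|} * koszul {|s|} {|t|} = (1 :: 'r::comm_ring_1)"
  by (simp add: koszul_singleton)

text \<open>The sum extracts the element of a singleton without a choice operator and is zero on all
  other monomials.\<close>

definition mono1 :: "('g \<Rightarrow> 'r::comm_ring_1) \<Rightarrow> 'g fset \<Rightarrow> 'r"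
  where "mono1 v S = (\<Sum>s\<in>fset S. if S = {|s|} then v s else 0)"

text \<open>
  The value of the monomial \<open>s t\<close> is the determinant \<open>v s * w t - v t * w s\<close>, written
  symmetrically in the two generators.
\<close>

definition mono2 :: "('g::countable \<Rightarrow> 'r::comm_ring_1) \<Rightarrow> ('g \<Rightarrow> 'r) \<Rightarrow> 'g fset \<Rightarrow> 'r"
  where "mono2 v w S = (\<Sum>s\<in>fset S. \<Sum>t\<in>fset S.
     if S = {|s, t|} then koszul {|s|} {|t|} * v s * w t else 0)"

lemma mono1_singleton [simp]: "mono1 v {|s|} = v s"
  by (simp add: mono1_def)

lemma mono2_pair: "s \<noteq> t \<Longrightarrow> mono2 v w {|s, t|} = koszul {|s|} {|t|} * (v s * w t - v t * w s)"
  unfolding mono2_def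
  by (simp add: koszul_singleton[of s s] koszul_singleton[of t t] koszul_singleton_swap[of t s]
      finsert_commute algebra_simps)

text \<open>The Koszul sign enters twice, from the product and from \<open>mono2\<close>, and
  squares to one. The value is thus independent of the enumeration of the generators; for
  \<open>s = t\<close> both sides vanish.\<close>

lemma ev_gen_odot_gen:
  fixes v w :: "'g::countable \<Rightarrow> 'r::comm_ring_1"
  shows "ev (mono2 v w) (Poly_Mapping.single ({|s|} |\<union>| {|t|}) (koszul {|s|} {|t|} * c)) =
    c * (v s * w t - v t * w s)"
proof (cases "s = t")
  case False
  let ?k = "koszul {|s|} {|t|} :: 'r"
  have "?k * c * (?k * d) = (?k * ?k) * (c * d)" for d
    by (simp only: mult_ac)
  then have "?k * c * (?k * d) = c * d" for d
    using koszul_singleton_square[OF False, where 'r = 'r] by simp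
  moreover have "{|s|} |\<union>| {|t|} = {|s, t|}"
    by auto
  ultimately show ?thesis
    by (simp only: ev_single mono2_pair[OF False])
qed (simp add: koszul_singleton)

section \<open>Homogeneous elements of the Grassmann algebra\<close>

definition homog :: "nat \<Rightarrow> ('g fset \<Rightarrow>\<^sub>0 'r::zero) \<Rightarrow> bool"
  where "homog n a \<longleftrightarrow> (\<forall>S\<in>Poly_Mapping.keys a. fcard S = n)"

lemma homog_0 [simp]: "homog n 0"
  by (simp add: homog_def)

lemma homog_add: "homog n a \<Longrightarrow> homog n b \<Longrightarrow> homog n (a + b)"
  unfolding homog_def by (meson Poly_Mapping.keys_add UnE subsetD)

lemma homog_uminus: "homog n a \<Longrightarrow> homog n (- a)" for a :: "'g fset \<Rightarrow>\<^sub>0 'r::comm_ring_1"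
  by (simp add: homog_def)

lemma homog_diff: "homog n a \<Longrightarrow> homog n b \<Longrightarrow> homog n (a - b)" for a :: "'g fset \<Rightarrow>\<^sub>0 'r::comm_ring_1"
  using homog_add[OF _ homog_uminus, of n a b] by simp

lemma homog_sum: "(\<And>i. i \<in> I \<Longrightarrow> homog n (g i)) \<Longrightarrow> homog n (sum g I)"
  by (induction I rule: infinite_finite_induct) (simp_all add: homog_add)

lemma homog_Sum_any: "(\<And>i. homog n (g i)) \<Longrightarrow> homog n (Sum_any g)"
  by (simp add: Sum_any.expand_set homog_sum)

lemma homog_single: "fcard S = n \<Longrightarrow> homog n (Poly_Mapping.single S c)"
  by (simp add: homog_def)

lemma homog_gen: "homog 1 (gen s)"
  by (simp add: gen_def homog_def fcard.rep_eq)

lemma homog_lookup_mono: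
  "homog n a \<Longrightarrow> (\<And>S. Poly_Mapping.lookup a S = 0 \<Longrightarrow> Poly_Mapping.lookup b S = 0) \<Longrightarrow> homog n b"
  by (auto simp: homog_def in_keys_iff)

lemma homog_gscale: "homog n a \<Longrightarrow> homog n (gscale c a)"
  by (erule homog_lookup_mono) (simp add: lookup_gscale)

lemma homog_map: "homog n a \<Longrightarrow> homog n (Poly_Mapping.map g a)"
  by (erule homog_lookup_mono) (simp add: map.rep_eq when_def)

lemma homog_odot: "homog m a \<Longrightarrow> homog n b \<Longrightarrow> homog (m + n) (a \<odot> b)"
  unfolding gmult_def
proof (intro homog_sum)
  fix S T assume "homog m a" "homog n b" "S \<in> Poly_Mapping.keys a" "T \<in> Poly_Mapping.keys b"
  then have "fcard S = m" "fcard T = n"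
    by (auto simp: homog_def)
  then show "homog (m + n) (Poly_Mapping.single (S |\<union>| T)
      (koszul S T * Poly_Mapping.lookup a S * Poly_Mapping.lookup b T))"
    by (cases "S |\<inter>| T = {||}") (simp_all add: homog_single fcard_funion_disjoint koszul_def)
qed

lemma homog_lderiv: "homog (Suc n) a \<Longrightarrow> homog n (lderiv s a)"
  unfolding lderiv_def
  by (rule homog_sum, rule homog_single) (auto simp: homog_def fcard_fminus_fsingleton)

lemma homog_gen_odot_lderiv: "homog n a \<Longrightarrow> homog n (gen t \<odot> lderiv s a)"
proof (cases n)
  case 0
  assume "homog n a"
  then have "{S \<in> Poly_Mapping.keys a. s |\<in>| S} = {}"
    unfolding 0 homog_def by auto
  then have "lderiv s a = 0"
    unfolding lderiv_def by (simp only: sum.empty)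
  then show ?thesis by simp
next
  case (Suc k)
  assume "homog n a"
  then show ?thesis
    using homog_odot[OF homog_gen homog_lderiv, of k a t s] Suc by simp
qed

lemma homog_tDx: "homog n a \<Longrightarrow> homog n (tDx a)"
  unfolding tDx_def
  by (intro homog_add homog_map homog_sum homog_Sum_any homog_gen_odot_lderiv)

lemma homog_tDx_pow: "homog n a \<Longrightarrow> homog n ((tDx ^^ k) a)"
  by (induction k) (simp_all add: homog_tDx)

lemma homog_1_cases:
  assumes "homog 1 a" "S \<in> Poly_Mapping.keys a"
  obtains s where "S = {|s|}"
proof -
  have "card (fset S) = 1"
    using assms by (simp add: homog_def fcard.rep_eq)
  then obtain s where "fset S = {s}"
    by (rule card_1_singletonE)
  then show thesis
    by (intro that[of s]) (simp add: fset_inject[symmetric])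
qed

lemma homog_2_cases:
  assumes "homog 2 a" "S \<in> Poly_Mapping.keys a"
  obtains s t where "S = {|s, t|}" "s \<noteq> t"
proof -
  have "card (fset S) = 2"
    using assms by (simp add: homog_def fcard.rep_eq)
  then obtain s t where "fset S = {s, t}" "s \<noteq> t"
    by (auto simp: card_2_iff)
  then show thesis
    by (intro that[of s t]) (simp_all add: fset_inject[symmetric])
qed

text \<open>Bilinear extension of \<open>ev_gen_odot_gen\<close>: products of odd factors become
  alternations over the two substitutions.\<close>

lemma ev_odot:
  assumes "homog 1 a" "homog 1 b"
  shows "ev (mono2 v w) (a \<odot> b) =
    ev (mono1 v) a * ev (mono1 w) b - ev (mono1 w) a * ev (mono1 v) b"
proof -
  have "ev (mono2 v w) (Poly_Mapping.single (S |\<union>| T)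
        (koszul S T * Poly_Mapping.lookup a S * Poly_Mapping.lookup b T)) =
      (Poly_Mapping.lookup a S * mono1 v S) * (Poly_Mapping.lookup b T * mono1 w T) -
      (Poly_Mapping.lookup a S * mono1 w S) * (Poly_Mapping.lookup b T * mono1 v T)"
    if S: "S \<in> Poly_Mapping.keys a" and T: "T \<in> Poly_Mapping.keys b" for S T
  proof -
    obtain s where s: "S = {|s|}" using homog_1_cases[OF assms(1) S] .
    obtain t where t: "T = {|t|}" using homog_1_cases[OF assms(2) T] .
    show ?thesis
      unfolding s t mult.assoc[of "koszul _ _"] ev_gen_odot_gen by (simp add: algebra_simps)
  qed
  then show ?thesis
    by (simp add: gmult_def ev_sum sum_subtractf) (simp add: ev_def sum_product)
qed

section \<open>The lifted total derivative under evaluation\<close>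

fun shift :: "'m oddvar \<Rightarrow> 'm oddvar" where
  "shift (Oq j k) = Oq j (Suc k)"
| "shift (Op j k) = Op j (Suc k)"

lemma sum_oddvar:
  fixes g :: "'m::finite oddvar \<Rightarrow> 'a::comm_monoid_add"
  assumes "finite V" and zero: "\<And>s. s \<notin> V \<Longrightarrow> g s = 0"
  shows "(\<Sum>j\<in>UNIV. Sum_any (\<lambda>k. g (Oq j k) + g (Op j k))) = (\<Sum>s\<in>V. g s)"
proof -
  \<comment> \<open>A bound on the jet order over \<open>V\<close> confines both families of
    variables to \<open>k < N\<close>.\<close>
  define ord :: "'m oddvar \<Rightarrow> nat" where "ord = (\<lambda>s. case s of Oq j k \<Rightarrow> k | Op j k \<Rightarrow> k)"
  obtain N where N: "\<And>s. s \<in> V \<Longrightarrow> ord s < N"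
    using finite_nat_set_iff_bounded[of "ord ` V"] \<open>finite V\<close> by auto
  have zero': "g (Oq j k) = 0" "g (Op j k) = 0" if "k \<ge> N" for j k
    using that N[of "Oq j k"] N[of "Op j k"] zero by (force simp: ord_def)+
  let ?Q = "(\<lambda>(j, k). Oq j k) ` (UNIV \<times> {..<N}) :: 'm oddvar set"
  let ?P = "(\<lambda>(j, k). Op j k) ` (UNIV \<times> {..<N}) :: 'm oddvar set"
  have "(\<Sum>j\<in>UNIV. Sum_any (\<lambda>k. g (Oq j k) + g (Op j k))) =
      (\<Sum>j\<in>UNIV. \<Sum>k<N. g (Oq j k)) + (\<Sum>j\<in>UNIV. \<Sum>k<N. g (Op j k))"
    by (subst Sum_any_finite_UNIV_supset[of "{..<N}"]) (simp_all add: zero' sum.distrib)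
  also have "\<dots> = sum g ?Q + sum g ?P"
    by (simp add: sum.reindex inj_on_def sum.cartesian_product o_def case_prod_unfold)
  also have "\<dots> = sum g (?Q \<union> ?P)"
    by (rule sum.union_disjoint[symmetric]) auto
  also have "\<dots> = sum g V"
  proof (rule sum.mono_neutral_right)
    show "V \<subseteq> ?Q \<union> ?P"
    proof
      fix s assume "s \<in> V"
      then have "ord s < N" by (rule N)
      then show "s \<in> ?Q \<union> ?P"
        by (cases s) (auto simp: ord_def)
    qed
  qed (auto intro: zero)
  finally show ?thesis .
qed

lemma lderiv_eq_0: "(\<And>S. S \<in> Poly_Mapping.keys a \<Longrightarrow> s |\<notin>| S) \<Longrightarrow> lderiv s a = 0"
proof -
  assume "\<And>S. S \<in> Poly_Mapping.keys a \<Longrightarrow> s |\<notin>| S"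
  then have "{S \<in> Poly_Mapping.keys a. s |\<in>| S} = {}"
    by auto
  then show ?thesis
    unfolding lderiv_def by (simp only: sum.empty)
qed

definition gens :: "('g fset \<Rightarrow>\<^sub>0 'r::zero) \<Rightarrow> 'g set"
  where "gens a = (\<Union>S\<in>Poly_Mapping.keys a. fset S)"

lemma finite_gens [simp]: "finite (gens a)"
  by (simp add: gens_def)

text \<open>Only generators that occur in \<open>a\<close> contribute, since \<open>lderiv\<close>
  annihilates elements free of the generator; the two families of variables merge into one finite
  sum.\<close>

lemma tDx_alt: "tDx a = Poly_Mapping.map Dx a + (\<Sum>s\<in>gens a. gen (shift s) \<odot> lderiv s a)"
  unfolding tDx_def
  by (subst sum_oddvar[of "gens a" "\<lambda>s. gen (shift s) \<odot> lderiv s a", symmetric])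
    (auto simp: gens_def lderiv_eq_0)

lemma ev_gen_odot:
  "ev m (gen t \<odot> b) = ev (\<lambda>T. koszul {|t|} T * m (finsert t T)) b"
  by (simp add: gmult_def gen_def ev_sum ev_single) (simp add: ev_def mult_ac)

lemma ev_lderiv:
  "ev m (lderiv s a) =
    (\<Sum>S\<in>Poly_Mapping.keys a. if s |\<in>| S then Poly_Mapping.lookup a S *
      (koszul {|s|} (S |-| {|s|}) * m (S |-| {|s|})) else 0)"
  unfolding lderiv_def ev_sum ev_single
  by (subst sum.inter_filter[symmetric]) (simp_all add: mult_ac)

lemma ev_map_Dx: "ev m (Poly_Mapping.map Dx a) = (\<Sum>S\<in>Poly_Mapping.keys a. Dx (Poly_Mapping.lookup a S) * m S)"
  by (subst ev_superset[of "Poly_Mapping.keys a"])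
    (auto simp: in_keys_iff map.rep_eq when_def intro!: sum.cong)

text \<open>By linearity a Leibniz rule on monomials suffices. Its right-hand side replaces one
  generator at a time by its shift, with one sign for taking it out and one for multiplying the
  shift back in.\<close>

lemma ev_tDx:
  assumes "homog n a"
    and m: "\<And>S. fcard S = n \<Longrightarrow> Dx (m S) = (\<Sum>s\<in>fset S. koszul {|s|} (S |-| {|s|}) *
      (koszul {|shift s|} (S |-| {|s|}) * m (finsert (shift s) (S |-| {|s|}))))"
  shows "ev m (tDx a) = Dx (ev m a)"
proof -
  let ?c = "\<lambda>s S. koszul {|s|} (S |-| {|s|}) *
      (koszul {|shift s|} (S |-| {|s|}) * m (finsert (shift s) (S |-| {|s|})))"
  have "ev m (\<Sum>s\<in>gens a. gen (shift s) \<odot> lderiv s a) = (\<Sum>s\<in>gens a. \<Sum>S\<in>Poly_Mapping.keys a.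
      if s |\<in>| S then Poly_Mapping.lookup a S * ?c s S else 0)"
    by (simp add: ev_sum ev_gen_odot ev_lderiv)
  also have "\<dots> = (\<Sum>S\<in>Poly_Mapping.keys a. \<Sum>s\<in>gens a.
      if s |\<in>| S then Poly_Mapping.lookup a S * ?c s S else 0)"
    by (rule sum.swap)
  also have "\<dots> = (\<Sum>S\<in>Poly_Mapping.keys a. Poly_Mapping.lookup a S * Dx (m S))"
  proof (rule sum.cong[OF refl])
    fix S assume S: "S \<in> Poly_Mapping.keys a"
    then have "fset S \<subseteq> gens a" by (auto simp: gens_def)
    then have "(\<Sum>s\<in>gens a. if s |\<in>| S then Poly_Mapping.lookup a S * ?c s S else 0) =
        (\<Sum>s\<in>fset S. Poly_Mapping.lookup a S * ?c s S)"
      by (intro sum.mono_neutral_cong_right) auto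
    then show "(\<Sum>s\<in>gens a. if s |\<in>| S then Poly_Mapping.lookup a S * ?c s S else 0) =
        Poly_Mapping.lookup a S * Dx (m S)"
      using assms(1) S by (simp add: m homog_def sum_distrib_left)
  qed
  finally show ?thesis
    unfolding tDx_alt ev_add ev_map_Dx by (simp add: ev_def Dx_sum Dx_mult sum.distrib)
qed

lemma Dx_koszul_singleton_mult: "Dx (koszul {|s|} {|t|} * g) = koszul {|s|} {|t|} * Dx g"
  by (simp add: koszul_singleton Dx_uminus)

text \<open>The case \<open>s = t\<close>, where both sides vanish, is included on purpose: the
  shift of one generator of a pair may be the other one.\<close>

lemma koszul_mono2: "koszul {|s|} {|t|} * mono2 v w (finsert s {|t|}) = v s * w t - v t * w s"
  using ev_gen_odot_gen[of v w s t 1] by (simp add: ev_single finsert_commute)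

definition jet :: "'m::finite vfun \<Rightarrow> 'm vfun \<Rightarrow> 'm oddvar \<Rightarrow> 'm dfun"
  where "jet \<psi> \<phi> s = (case s of Op j k \<Rightarrow> (Dx ^^ k) (\<psi> $ j) | Oq j k \<Rightarrow> (Dx ^^ k) (\<phi> $ j))"

lemma Dx_jet: "Dx (jet \<psi> \<phi> s) = jet \<psi> \<phi> (shift s)"
  by (cases s) (simp_all add: jet_def)

lemma ev_mono1_tDx:
  assumes "homog 1 a" and v: "\<And>s. Dx (v s) = v (shift s)"
  shows "ev (mono1 v) (tDx a) = Dx (ev (mono1 v) a)"
proof (rule ev_tDx[OF assms(1)])
  fix S :: "'a oddvar fset"
  assume "fcard S = 1"
  then have "card (fset S) = 1"
    by (simp add: fcard.rep_eq)
  then obtain s where "fset S = {s}"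
    by (rule card_1_singletonE)
  then have "S = {|s|}"
    by (simp add: fset_inject[symmetric])
  moreover have "{|s|} |-| {|s|} = {||}" by auto
  ultimately show "Dx (mono1 v S) = (\<Sum>s\<in>fset S. koszul {|s|} (S |-| {|s|}) *
      (koszul {|shift s|} (S |-| {|s|}) * mono1 v (finsert (shift s) (S |-| {|s|}))))"
    by (simp add: koszul_empty v)
qed

text \<open>In degree two the Leibniz rule asked for by \<open>ev_tDx\<close> is the product rule
  for a two-by-two determinant.\<close>

lemma ev_mono2_tDx:
  assumes "homog 2 a" and v: "\<And>s. Dx (v s) = v (shift s)" and w: "\<And>s. Dx (w s) = w (shift s)"
  shows "ev (mono2 v w) (tDx a) = Dx (ev (mono2 v w) a)"
proof (rule ev_tDx[OF assms(1)])
  fix S :: "'a oddvar fset"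
  assume "fcard S = 2"
  then have "card (fset S) = 2"
    by (simp add: fcard.rep_eq)
  then obtain s t where "fset S = {s, t}" and ne: "s \<noteq> t"
    by (auto simp: card_2_iff)
  then have S: "S = {|s, t|}"
    by (simp add: fset_inject[symmetric])
  have diff: "{|s, t|} |-| {|s|} = {|t|}" "{|s, t|} |-| {|t|} = {|s|}"
    using ne by auto
  show "Dx (mono2 v w S) = (\<Sum>s\<in>fset S. koszul {|s|} (S |-| {|s|}) *
      (koszul {|shift s|} (S |-| {|s|}) * mono2 v w (finsert (shift s) (S |-| {|s|}))))"
    unfolding S mono2_pair[OF ne] Dx_koszul_singleton_mult koszul_mono2
    using ne by (simp add: diff koszul_mono2 koszul_singleton_swap[of t s] Dx_diff Dx_mult v w algebra_simps)
qed

section \<open>Vectors of odd functions and lifted operators\<close>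

definition evv :: "('m oddvar fset \<Rightarrow> 'm::finite dfun) \<Rightarrow> 'm vsfun \<Rightarrow> 'm vfun"
  where "evv m G = (\<chi> l. ev m (G $ l))"

definition vhomog :: "nat \<Rightarrow> 'm::finite vsfun \<Rightarrow> bool"
  where "vhomog n G \<longleftrightarrow> (\<forall>l. homog n (G $ l))"

lemma evv_add: "evv m (G + H) = evv m G + evv m H"
  and evv_diff: "evv m (G - H) = evv m G - evv m H"
  and evv_uminus: "evv m (- G) = - evv m G"
  by (simp_all add: evv_def vec_eq_iff ev_add ev_diff ev_uminus)

lemma evv_vscale: "evv m (vscale c G) $ l = c * evv m G $ l"
  by (simp add: evv_def vscale_def ev_gscale)

lemma vhomog_add: "vhomog n G \<Longrightarrow> vhomog n H \<Longrightarrow> vhomog n (G + H)"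
  and vhomog_diff: "vhomog n G \<Longrightarrow> vhomog n H \<Longrightarrow> vhomog n (G - H)"
  and vhomog_uminus: "vhomog n G \<Longrightarrow> vhomog n (- G)"
  and vhomog_vscale: "vhomog n G \<Longrightarrow> vhomog n (vscale c G)"
  by (simp_all add: vhomog_def vscale_def homog_add homog_diff homog_uminus homog_gscale)

lemma homog_tpd: "homog n a \<Longrightarrow> homog n (tpd c a)"
  by (simp add: tpd_def homog_map)

lemma vhomog_tapp: "vhomog n G \<Longrightarrow> vhomog n (tapp A G)"
  by (simp add: vhomog_def tapp_def homog_sum homog_gscale homog_tDx_pow)

lemma vhomog_tlin: "vhomog 1 G \<Longrightarrow> vhomog 1 H \<Longrightarrow> vhomog 2 (tlin G H)"
  unfolding vhomog_def tlin_def one_add_one[symmetric] vec_lambda_beta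
  by (intro allI homog_sum homog_Sum_any homog_odot homog_tpd homog_tDx_pow) blast+

lemma vhomog_tlin_adj: "vhomog 1 G \<Longrightarrow> vhomog 1 H \<Longrightarrow> vhomog 2 (tlin_adj G H)"
  unfolding vhomog_def tlin_adj_def one_add_one[symmetric] vec_lambda_beta
  by (intro allI homog_sum homog_Sum_any homog_gscale homog_tDx_pow homog_odot homog_tpd) blast+

lemma vhomog_pv: "vhomog 1 pv" and vhomog_qv: "vhomog 1 qv"
  by (simp_all add: vhomog_def pv_def qv_def homog_gen[simplified])

lemma vhomog_shadow: "vhomog 1 (shadow_H A)" "vhomog 1 (shadow_N R)"
  unfolding shadow_eq_tapp by (intro vhomog_tapp vhomog_pv vhomog_qv)+

lemma ev_tDx_pow:
  assumes "\<And>a. homog n a \<Longrightarrow> ev m (tDx a) = Dx (ev m a)" and "homog n a"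
  shows "ev m ((tDx ^^ k) a) = (Dx ^^ k) (ev m a)"
  by (induction k) (simp_all add: assms homog_tDx_pow)

lemma evv_tapp:
  fixes G :: "'m::finite vsfun"
  assumes m: "\<And>a. homog n a \<Longrightarrow> ev m (tDx a) = Dx (ev m a)" and G: "vhomog n G"
  shows "evv m (tapp A G) = app A (evv m G)"
proof -
  have "ev m ((tDx ^^ i) (G $ j)) = (Dx ^^ i) (ev m (G $ j))" for i :: nat and j
    by (rule ev_tDx_pow[of n]) (fact m, use G in \<open>simp add: vhomog_def\<close>)
  then show ?thesis
    by (simp add: vec_eq_iff evv_def tapp_def app_def sapp_def ev_sum ev_gscale)
qed

lemma evv_tapp_mono1:
  "vhomog 1 G \<Longrightarrow> evv (mono1 (jet \<psi> \<phi>)) (tapp A G) = app A (evv (mono1 (jet \<psi> \<phi>)) G)"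
  by (rule evv_tapp) (rule ev_mono1_tDx, assumption, rule Dx_jet)

lemma evv_tapp_mono2:
  "vhomog 2 G \<Longrightarrow> evv (mono2 (jet \<psi>\<^sub>1 \<phi>\<^sub>1) (jet \<psi>\<^sub>2 \<phi>\<^sub>2)) (tapp A G) =
    app A (evv (mono2 (jet \<psi>\<^sub>1 \<phi>\<^sub>1) (jet \<psi>\<^sub>2 \<phi>\<^sub>2)) G)"
  by (rule evv_tapp) (rule ev_mono2_tDx, assumption, rule Dx_jet, rule Dx_jet)

lemma evv_pv: "evv (mono1 (jet \<psi> \<phi>)) pv = \<psi>"
  and evv_qv: "evv (mono1 (jet \<psi> \<phi>)) qv = \<phi>"
  by (simp_all add: evv_def pv_def qv_def gen_def ev_single jet_def vec_eq_iff)

lemma evv_shadow: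
  "evv (mono1 (jet \<psi> \<phi>)) (shadow_H A) = app A \<psi>"
  "evv (mono1 (jet \<psi> \<phi>)) (shadow_N R) = app R \<phi>"
  by (simp_all only: shadow_eq_tapp evv_tapp_mono1 vhomog_pv vhomog_qv evv_pv evv_qv)

section \<open>Linearizations of the shadows\<close>

lemma lookup_tpd: "Poly_Mapping.lookup (tpd c a) S = pd c (Poly_Mapping.lookup a S)"
  by (simp add: tpd_def map.rep_eq when_def)

lemma tpd_add: "tpd c (a + b) = tpd c a + tpd c b"
  by (rule poly_mapping_eqI) (simp add: lookup_tpd lookup_add pd_add)

lemma tpd_0 [simp]: "tpd c 0 = 0"
  by (rule poly_mapping_eqI) (simp add: lookup_tpd)

lemma tpd_sum: "tpd c (sum g I) = (\<Sum>i\<in>I. tpd c (g i))"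
  by (induction I rule: infinite_finite_induct) (simp_all add: tpd_add)

lemma tpd_gscale_gen: "tpd c (gscale b (gen s)) = gscale (pd c b) (gen s)"
  by (rule poly_mapping_eqI) (simp add: lookup_tpd lookup_gscale gen_def lookup_single when_def)

lemma finite_tpd: "finite {k. tpd (Cu j k) a \<noteq> 0}"
proof (rule finite_subset)
  show "{k. tpd (Cu j k) a \<noteq> 0} \<subseteq>
      (\<Union>S\<in>Poly_Mapping.keys a. {k. pd (Cu j k) (Poly_Mapping.lookup a S) \<noteq> 0})"
  proof clarify
    fix k assume ne: "tpd (Cu j k) a \<noteq> 0"
    then obtain S where S: "pd (Cu j k) (Poly_Mapping.lookup a S) \<noteq> 0"
      by (metis lookup_tpd poly_mapping_eqI lookup_zero)
    then have "S \<in> Poly_Mapping.keys a"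
      by (auto simp: in_keys_iff)
    with S show "k \<in> (\<Union>S\<in>Poly_Mapping.keys a. {k. pd (Cu j k) (Poly_Mapping.lookup a S) \<noteq> 0})"
      by blast
  qed
qed (simp add: finite_pd_Cu)

lemma lookup_lin_op:
  "Poly_Mapping.lookup (lin_op \<Delta> \<psi> $ l $ j) k = (\<Sum>s\<in>UNIV. \<Sum>i\<in>Poly_Mapping.keys (\<Delta> $ l $ s).
     pd (Cu j k) (Poly_Mapping.lookup (\<Delta> $ l $ s) i) * (Dx ^^ i) (\<psi> $ s))"
  by (auto simp: lin_op_def lookup_sum map.rep_eq when_def slin.rep_eq intro!: sum.cong)

text \<open>Common interface of both kinds of shadow, so that \<open>tlin\<close> and
  \<open>tlin_adj\<close> need to be evaluated only once.\<close>

definition represents :: "('m::finite oddvar \<Rightarrow> 'm dfun) \<Rightarrow> 'm vsfun \<Rightarrow> 'm cdo \<Rightarrow> 'm vfun \<Rightarrow> bool"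
  where "represents v G \<Delta> \<psi> \<longleftrightarrow> (\<forall>l j k. ev (mono1 v) (tpd (Cu j k) (G $ l)) =
     Poly_Mapping.lookup (lin_op \<Delta> \<psi> $ l $ j) k)"

text \<open>The odd variables are independent of \<open>u\<close>, so \<open>tpd\<close>
  differentiates only the coefficients of the operator; substituting jets yields the coefficients of
  \<open>lin_op\<close>.\<close>

lemma represents_shadow:
  "represents (jet \<psi> \<phi>) (shadow_H A) A \<psi>"
  "represents (jet \<psi> \<phi>) (shadow_N R) R \<phi>"
  by (simp_all add: represents_def shadow_H_def shadow_N_def tpd_sum tpd_gscale_gen ev_sum
      ev_gscale lookup_lin_op) (simp_all add: gen_def ev_single jet_def)

lemma gscale_0 [simp]: "gscale c 0 = 0"
  by (rule poly_mapping_eqI) (simp add: lookup_gscale)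

lemma odot_0_left [simp]: "0 \<odot> a = 0"
  by (simp add: gmult_def)

lemma map_Dx_0: "Poly_Mapping.map Dx 0 = 0"
  by (rule poly_mapping_eqI) (simp add: map.rep_eq)

lemma tDx_0 [simp]: "tDx 0 = 0"
  by (simp add: tDx_alt gens_def map_Dx_0)

lemma tDx_pow_0 [simp]: "(tDx ^^ k) 0 = 0"
  by (induction k) simp_all

lemma sapp_sadj_supset:
  assumes "finite I" "Poly_Mapping.keys a \<subseteq> I"
  shows "sapp (sadj a) g = (\<Sum>i\<in>I. (-1) ^ i * (Dx ^^ i) (Poly_Mapping.lookup a i * g))"
  unfolding sapp_sadj using assms by (intro sum.mono_neutral_left) (auto simp: in_keys_iff)

text \<open>By \<open>ev_odot\<close> each product gives two terms: one substitution goes into the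
  differentiated shadow, the other into the argument.\<close>

lemma evv_tlin:
  assumes "represents (jet \<psi>\<^sub>1 \<phi>\<^sub>1) G \<Delta> \<chi>\<^sub>1" "represents (jet \<psi>\<^sub>2 \<phi>\<^sub>2) G \<Delta> \<chi>\<^sub>2"
    and G: "vhomog 1 G" and H: "vhomog 1 H"
  shows "evv (mono2 (jet \<psi>\<^sub>1 \<phi>\<^sub>1) (jet \<psi>\<^sub>2 \<phi>\<^sub>2)) (tlin G H) =
    app (lin_op \<Delta> \<chi>\<^sub>1) (evv (mono1 (jet \<psi>\<^sub>2 \<phi>\<^sub>2)) H) -
    app (lin_op \<Delta> \<chi>\<^sub>2) (evv (mono1 (jet \<psi>\<^sub>1 \<phi>\<^sub>1)) H)"
proof -
  let ?v = "jet \<psi>\<^sub>1 \<phi>\<^sub>1" and ?w = "jet \<psi>\<^sub>2 \<phi>\<^sub>2"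
  have pow: "ev (mono1 (jet \<psi> \<phi>)) ((tDx ^^ k) (H $ j)) = (Dx ^^ k) (ev (mono1 (jet \<psi> \<phi>)) (H $ j))"
    for \<psi> \<phi> k j
    by (rule ev_tDx_pow[of 1]) (rule ev_mono1_tDx, assumption, rule Dx_jet, use H in \<open>simp add: vhomog_def\<close>)
  have "ev (mono2 ?v ?w) (Sum_any (\<lambda>k. tpd (Cu j k) (G $ l) \<odot> (tDx ^^ k) (H $ j))) =
      sapp (lin_op \<Delta> \<chi>\<^sub>1 $ l $ j) (ev (mono1 ?w) (H $ j)) -
      sapp (lin_op \<Delta> \<chi>\<^sub>2 $ l $ j) (ev (mono1 ?v) (H $ j))" for l j
  proof -
    \<comment> \<open>A common finite index set for the formal sum and for both operators on the
      right.\<close>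
    define K where "K = {k. tpd (Cu j k) (G $ l) \<noteq> 0} \<union>
      Poly_Mapping.keys (lin_op \<Delta> \<chi>\<^sub>1 $ l $ j) \<union> Poly_Mapping.keys (lin_op \<Delta> \<chi>\<^sub>2 $ l $ j)"
    have K: "finite K" by (simp add: K_def finite_tpd)
    have "Sum_any (\<lambda>k. tpd (Cu j k) (G $ l) \<odot> (tDx ^^ k) (H $ j)) =
        (\<Sum>k\<in>K. tpd (Cu j k) (G $ l) \<odot> (tDx ^^ k) (H $ j))"
      by (rule Sum_any_finite_UNIV_supset[OF K]) (simp add: K_def)
    moreover have "ev (mono2 ?v ?w) (tpd (Cu j k) (G $ l) \<odot> (tDx ^^ k) (H $ j)) =
        Poly_Mapping.lookup (lin_op \<Delta> \<chi>\<^sub>1 $ l $ j) k * (Dx ^^ k) (ev (mono1 ?w) (H $ j)) -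
        Poly_Mapping.lookup (lin_op \<Delta> \<chi>\<^sub>2 $ l $ j) k * (Dx ^^ k) (ev (mono1 ?v) (H $ j))" for k
      using assms by (subst ev_odot) (simp_all add: homog_tpd homog_tDx_pow vhomog_def represents_def pow)
    moreover have "Poly_Mapping.keys (lin_op \<Delta> \<chi>\<^sub>1 $ l $ j) \<subseteq> K" "Poly_Mapping.keys (lin_op \<Delta> \<chi>\<^sub>2 $ l $ j) \<subseteq> K"
      by (auto simp: K_def)
    ultimately show ?thesis
      by (simp add: ev_sum sum_subtractf sapp_supset[OF K])
  qed
  then show ?thesis
    by (simp add: evv_def tlin_def app_def vec_eq_iff ev_sum sum_subtractf)
qed

lemma evv_tlin_adj:
  assumes "represents (jet \<psi>\<^sub>1 \<phi>\<^sub>1) G \<Delta> \<chi>\<^sub>1" "represents (jet \<psi>\<^sub>2 \<phi>\<^sub>2) G \<Delta> \<chi>\<^sub>2"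
    and G: "vhomog 1 G" and H: "vhomog 1 H"
  shows "evv (mono2 (jet \<psi>\<^sub>1 \<phi>\<^sub>1) (jet \<psi>\<^sub>2 \<phi>\<^sub>2)) (tlin_adj G H) =
    app (adj (lin_op \<Delta> \<chi>\<^sub>1)) (evv (mono1 (jet \<psi>\<^sub>2 \<phi>\<^sub>2)) H) -
    app (adj (lin_op \<Delta> \<chi>\<^sub>2)) (evv (mono1 (jet \<psi>\<^sub>1 \<phi>\<^sub>1)) H)"
proof -
  let ?v = "jet \<psi>\<^sub>1 \<phi>\<^sub>1" and ?w = "jet \<psi>\<^sub>2 \<phi>\<^sub>2"
  have "ev (mono2 ?v ?w) (Sum_any (\<lambda>k. gscale ((-1) ^ k) ((tDx ^^ k) (tpd (Cu j k) (G $ l) \<odot> H $ l)))) =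
      sapp (sadj (lin_op \<Delta> \<chi>\<^sub>1 $ l $ j)) (ev (mono1 ?w) (H $ l)) -
      sapp (sadj (lin_op \<Delta> \<chi>\<^sub>2 $ l $ j)) (ev (mono1 ?v) (H $ l))" for l j
  proof -
    let ?a = "\<lambda>k. tpd (Cu j k) (G $ l) \<odot> H $ l"
    define K where "K = {k. tpd (Cu j k) (G $ l) \<noteq> 0} \<union>
      Poly_Mapping.keys (lin_op \<Delta> \<chi>\<^sub>1 $ l $ j) \<union> Poly_Mapping.keys (lin_op \<Delta> \<chi>\<^sub>2 $ l $ j)"
    have K: "finite K" by (simp add: K_def finite_tpd)
    have "Sum_any (\<lambda>k. gscale ((-1) ^ k) ((tDx ^^ k) (?a k))) = (\<Sum>k\<in>K. gscale ((-1) ^ k) ((tDx ^^ k) (?a k)))"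
      by (rule Sum_any_finite_UNIV_supset[OF K]) (simp add: K_def)
    moreover have "ev (mono2 ?v ?w) ((tDx ^^ k) (?a k)) =
        (Dx ^^ k) (Poly_Mapping.lookup (lin_op \<Delta> \<chi>\<^sub>1 $ l $ j) k * ev (mono1 ?w) (H $ l)) -
        (Dx ^^ k) (Poly_Mapping.lookup (lin_op \<Delta> \<chi>\<^sub>2 $ l $ j) k * ev (mono1 ?v) (H $ l))" for k
    proof -
      \<comment> \<open>Here the powers of \<open>tDx\<close> act on a product, so the degree-two
        rule is needed to take them out of the evaluation.\<close>
      have "homog 2 (?a k)"
        unfolding one_add_one[symmetric]
        using G H by (intro homog_odot homog_tpd) (simp_all add: vhomog_def)
      then have "ev (mono2 ?v ?w) ((tDx ^^ k) (?a k)) = (Dx ^^ k) (ev (mono2 ?v ?w) (?a k))"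
        by (intro ev_tDx_pow[of 2] ev_mono2_tDx Dx_jet) simp_all
      also have "ev (mono2 ?v ?w) (?a k) =
          Poly_Mapping.lookup (lin_op \<Delta> \<chi>\<^sub>1 $ l $ j) k * ev (mono1 ?w) (H $ l) -
          Poly_Mapping.lookup (lin_op \<Delta> \<chi>\<^sub>2 $ l $ j) k * ev (mono1 ?v) (H $ l)"
        using assms by (subst ev_odot) (simp_all add: homog_tpd vhomog_def represents_def)
      finally show ?thesis
        by (simp add: diff_conv_add_uminus Dx_pow_add Dx_pow_uminus del: add_uminus_conv_diff)
    qed
    moreover have "Poly_Mapping.keys (lin_op \<Delta> \<chi>\<^sub>1 $ l $ j) \<subseteq> K" "Poly_Mapping.keys (lin_op \<Delta> \<chi>\<^sub>2 $ l $ j) \<subseteq> K"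
      by (auto simp: K_def)
    ultimately show ?thesis
      by (simp add: ev_sum ev_gscale right_diff_distrib sum_subtractf sapp_sadj_supset[OF K])
  qed
  then show ?thesis
    by (simp add: evv_def tlin_adj_def app_def adj_def vec_eq_iff ev_sum sum_subtractf)
qed

section \<open>Faithfulness of the evaluation\<close>

lemma jet_nondegenerate:
  fixes c :: "'m::finite oddvar \<Rightarrow> 'm dfun"
  assumes V: "finite V" and zero: "\<And>\<psi> \<phi>. (\<Sum>s\<in>V. c s * jet \<psi> \<phi> s) = 0" and "s \<in> V"
  shows "c s = 0"
proof -
  \<comment> \<open>\<open>g\<close> stands for either constructor. The test jets \<open>u n\<close>
    vanish off the family \<open>g j\<close>, so the relation becomes an operator that annihilates
    every \<open>xdiv n\<close>.\<close>
  have *: "c (g j k) = 0" if g: "inj (\<lambda>(j, k). g j k)" and gV: "g j k \<in> V"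
    and u: "\<And>n. (\<Sum>s\<in>V. c s * u n s) = 0" "\<And>n i. u n (g j i) = (Dx ^^ i) (xdiv n)"
      "\<And>n s. s \<notin> range (g j) \<Longrightarrow> u n s = 0" for g :: "'m \<Rightarrow> nat \<Rightarrow> 'm oddvar" and u j k
  proof -
    have inj: "inj (g j)"
      using g by (auto simp: inj_def)
    let ?I = "g j -` V"
    have I: "finite ?I"
      using V inj by (rule finite_vimageI)
    have "(\<Sum>i\<in>?I. c (g j i) * (Dx ^^ i) (xdiv n)) = 0" for n
    proof -
      have "(\<Sum>i\<in>?I. c (g j i) * (Dx ^^ i) (xdiv n)) = (\<Sum>s\<in>g j ` ?I. c s * u n s)"
        by (subst sum.reindex) (simp_all add: inj_on_subset[OF inj] u(2) del: image_vimage_eq)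
      also have "\<dots> = (\<Sum>s\<in>V. c s * u n s)"
        by (rule sum.mono_neutral_left) (use V u(3) in auto)
      finally show ?thesis by (simp add: u(1))
    qed
    then show ?thesis
      using operator_coeffs_zero[OF I, of "\<lambda>i. c (g j i)" k] gV by simp
  qed
  \<comment> \<open>Sections whose only non-zero component is \<open>xdiv n\<close> in place
    \<open>j\<close>; the other member of the pair is taken to be zero.\<close>
  define e :: "'m \<Rightarrow> nat \<Rightarrow> 'm vfun" where "e = (\<lambda>j n. \<chi> i. if i = j then xdiv n else 0)"
  show ?thesis
  proof (cases s)
    case (Oq j k)
    have "c (Oq j k) = 0"
      by (rule *[of Oq j k "\<lambda>n. jet 0 (e j n)"])
        (use Oq \<open>s \<in> V\<close> zero in \<open>auto simp: inj_def jet_def e_def split: oddvar.split\<close>)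
    then show ?thesis using Oq by simp
  next
    case (Op j k)
    have "c (Op j k) = 0"
      by (rule *[of Op j k "\<lambda>n. jet (e j n) 0"])
        (use Op \<open>s \<in> V\<close> zero in \<open>auto simp: inj_def jet_def e_def split: oddvar.split\<close>)
    then show ?thesis using Op by simp
  qed
qed

text \<open>The value is arranged as a linear form in \<open>w\<close> whose coefficients are linear
  forms in \<open>v\<close>, so that \<open>jet_nondegenerate\<close> can be applied twice.\<close>

lemma ev_mono2_eq:
  "ev (mono2 v w) a = (\<Sum>t\<in>gens a. (\<Sum>s\<in>gens a.
     koszul {|s|} {|t|} * Poly_Mapping.lookup a {|s, t|} * v s) * w t)"
proof -
  let ?x = "\<lambda>s t. koszul {|s|} {|t|} * Poly_Mapping.lookup a {|s, t|} * v s * w t"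
  have "Poly_Mapping.lookup a S * mono2 v w S = (\<Sum>s\<in>gens a. \<Sum>t\<in>gens a. if S = {|s, t|} then ?x s t else 0)"
    if "S \<in> Poly_Mapping.keys a" for S
  proof -
    have "fset S \<subseteq> gens a"
      using that by (auto simp: gens_def)
    then have "(\<Sum>s\<in>gens a. \<Sum>t\<in>gens a. if S = {|s, t|} then ?x s t else 0) =
        (\<Sum>s\<in>fset S. \<Sum>t\<in>fset S. if S = {|s, t|} then ?x s t else 0)"
      by (intro sum.mono_neutral_cong_right) (auto intro!: sum.neutral sum.mono_neutral_cong_right)
    then show ?thesis
      by (auto simp: mono2_def sum_distrib_left mult_ac intro!: sum.cong)
  qed
  then have "ev (mono2 v w) a = (\<Sum>S\<in>Poly_Mapping.keys a. \<Sum>s\<in>gens a. \<Sum>t\<in>gens a. if S = {|s, t|} then ?x s t else 0)"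
    by (simp add: ev_def)
  also have "\<dots> = (\<Sum>s\<in>gens a. \<Sum>t\<in>gens a. \<Sum>S\<in>Poly_Mapping.keys a. if S = {|s, t|} then ?x s t else 0)"
    by (simp add: sum.swap[of _ _ "Poly_Mapping.keys a"])
  also have "\<dots> = (\<Sum>s\<in>gens a. \<Sum>t\<in>gens a. ?x s t)"
    by (intro sum.cong refl) (auto simp: in_keys_iff)
  also have "\<dots> = (\<Sum>t\<in>gens a. \<Sum>s\<in>gens a. ?x s t)"
    by (rule sum.swap)
  finally show ?thesis
    by (simp add: sum_distrib_right)
qed

lemma ev_mono2_nondegenerate:
  fixes a :: "'m::finite sfun"
  assumes "homog 2 a" and zero: "\<And>\<psi>\<^sub>1 \<phi>\<^sub>1 \<psi>\<^sub>2 \<phi>\<^sub>2. ev (mono2 (jet \<psi>\<^sub>1 \<phi>\<^sub>1) (jet \<psi>\<^sub>2 \<phi>\<^sub>2)) a = 0"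
  shows "a = 0"
proof (rule ccontr)
  assume "a \<noteq> 0"
  then obtain S where S: "S \<in> Poly_Mapping.keys a"
    by fastforce
  with assms(1) obtain s t where st: "S = {|s, t|}" "s \<noteq> t"
    by (rule homog_2_cases)
  then have gens: "s \<in> gens a" "t \<in> gens a"
    using S by (auto simp: gens_def)
  let ?c = "\<lambda>s t. koszul {|s|} {|t|} * Poly_Mapping.lookup a {|s, t|}"
  \<comment> \<open>The second pair of sections is separated first, with the first pair fixed; then
    the first pair.\<close>
  have "(\<Sum>s\<in>gens a. ?c s t * jet \<psi>\<^sub>1 \<phi>\<^sub>1 s) = 0" for \<psi>\<^sub>1 \<phi>\<^sub>1
    by (rule jet_nondegenerate[OF finite_gens _ gens(2)]) (use zero in \<open>simp add: ev_mono2_eq\<close>)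
  then have "?c s t = 0"
    by (rule jet_nondegenerate[OF finite_gens _ gens(1)])
  then have "Poly_Mapping.lookup a S = 0"
    using st by (auto simp: koszul_singleton split: if_splits)
  then show False
    using S by (simp add: in_keys_iff)
qed

lemma evv_mono2_nondegenerate:
  assumes "vhomog 2 G" and "\<And>\<psi>\<^sub>1 \<phi>\<^sub>1 \<psi>\<^sub>2 \<phi>\<^sub>2. evv (mono2 (jet \<psi>\<^sub>1 \<phi>\<^sub>1) (jet \<psi>\<^sub>2 \<phi>\<^sub>2)) G = 0"
  shows "G = 0"
proof -
  have "G $ l = 0" for l
    using assms by (intro ev_mono2_nondegenerate) (simp_all add: vhomog_def evv_def vec_eq_iff)
  then show ?thesis by (simp add: vec_eq_iff)
qed

section \<open>The brackets\<close>

lemma half_double: "dconst (1/2) * (g + g) = g"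
  by transfer simp

lemma bracket_HH_eq_0:
  assumes "hamiltonian A"
  shows "bracket_HH A A = 0"
proof (rule evv_mono2_nondegenerate)
  show "vhomog 2 (bracket_HH A A)"
    unfolding bracket_HH_def
    by (intro vhomog_diff vhomog_uminus vhomog_vscale vhomog_add vhomog_tapp vhomog_tlin
        vhomog_tlin_adj vhomog_shadow vhomog_pv)
next
  fix \<psi>\<^sub>1 \<phi>\<^sub>1 \<psi>\<^sub>2 \<phi>\<^sub>2 :: "'a vfun"
  let ?m = "mono2 (jet \<psi>\<^sub>1 \<phi>\<^sub>1) (jet \<psi>\<^sub>2 \<phi>\<^sub>2)"
  have skew: "adj A = - A"
    using assms by (simp add: hamiltonian_def)
  let ?X = "app (lin_op A \<psi>\<^sub>1) (app A \<psi>\<^sub>2) - app (lin_op A \<psi>\<^sub>2) (app A \<psi>\<^sub>1)"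
  let ?Y = "app A (app (adj (lin_op A \<psi>\<^sub>1)) \<psi>\<^sub>2)"
  have lin: "evv ?m (tlin (shadow_H A) (shadow_H A)) = ?X"
    by (simp add: evv_tlin[OF represents_shadow(1) represents_shadow(1)] vhomog_shadow[simplified] evv_shadow)
  have "evv ?m (tlin_adj (shadow_H A) pv) = app (adj (lin_op A \<psi>\<^sub>1)) \<psi>\<^sub>2 - app (adj (lin_op A \<psi>\<^sub>2)) \<psi>\<^sub>1"
    by (simp add: evv_tlin_adj[OF represents_shadow(1) represents_shadow(1)] vhomog_shadow[simplified]
        vhomog_pv[simplified] evv_pv)
  \<comment> \<open>By skewness the two terms of the alternation are equal and add up.\<close>
  also have "\<dots> = app (adj (lin_op A \<psi>\<^sub>1)) \<psi>\<^sub>2 + app (adj (lin_op A \<psi>\<^sub>1)) \<psi>\<^sub>2"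
    using app_adj_lin_op_skew[OF skew, of \<psi>\<^sub>1 \<psi>\<^sub>2] by simp
  finally have adj: "evv ?m (tapp A (tlin_adj (shadow_H A) pv)) = ?Y + ?Y"
    by (simp only: evv_tapp_mono2 vhomog_tlin_adj vhomog_shadow vhomog_pv app_add)
  \<comment> \<open>The factor one half absorbs this doubling, which gives the adjoint terms the
    same weight as the two linearizations.\<close>
  have "evv ?m (vscale (dconst (1/2)) (tapp A (tlin_adj (shadow_H A) pv) + tapp A (tlin_adj (shadow_H A) pv))) = ?Y + ?Y"
    by (simp only: vec_eq_iff evv_vscale evv_add vector_add_component half_double adj simp_thms)
  then have "evv ?m (bracket_HH A A) = - (?X + ?Y) - (?X + ?Y)"
    unfolding bracket_HH_def evv_diff evv_uminus lin by simp
  then show "evv ?m (bracket_HH A A) = 0"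
    by (simp only: hamiltonian_lin_op[OF assms]) simp
qed

lemma bracket_NN_eq_0:
  assumes "nijenhuis R"
  shows "bracket_NN R R = 0"
proof (rule evv_mono2_nondegenerate)
  show "vhomog 2 (bracket_NN R R)"
    unfolding bracket_NN_def
    by (intro vhomog_diff vhomog_uminus vhomog_add vhomog_tapp vhomog_tlin vhomog_shadow vhomog_qv)
next
  fix \<psi>\<^sub>1 \<phi>\<^sub>1 \<psi>\<^sub>2 \<phi>\<^sub>2 :: "'a vfun"
  let ?m = "mono2 (jet \<psi>\<^sub>1 \<phi>\<^sub>1) (jet \<psi>\<^sub>2 \<phi>\<^sub>2)"
  let ?X = "app (lin_op R \<phi>\<^sub>1) (app R \<phi>\<^sub>2) - app (lin_op R \<phi>\<^sub>2) (app R \<phi>\<^sub>1)"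
  let ?Y = "app R (app (lin_op R \<phi>\<^sub>1) \<phi>\<^sub>2 - app (lin_op R \<phi>\<^sub>2) \<phi>\<^sub>1)"
  have X: "evv ?m (tlin (shadow_N R) (shadow_N R)) = ?X"
    by (simp add: evv_tlin[OF represents_shadow(2) represents_shadow(2)] vhomog_shadow[simplified] evv_shadow)
  have Y: "evv ?m (tapp R (tlin (shadow_N R) qv)) = ?Y"
    by (simp add: evv_tapp_mono2 vhomog_tlin vhomog_shadow vhomog_qv
        evv_tlin[OF represents_shadow(2) represents_shadow(2)] vhomog_shadow[simplified] vhomog_qv[simplified] evv_qv)
  have "evv ?m (bracket_NN R R) = - (?X - ?Y) - (?X - ?Y)"
    unfolding bracket_NN_def evv_diff evv_uminus evv_add X Y by simp
  then show "evv ?m (bracket_NN R R) = 0"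
    by (simp only: nijenhuis_lin_op[OF assms]) simp
qed

lemma bracket_HN_eq_0:
  assumes "compatible A R" and RA: "\<And>\<psi>. app R (app A \<psi>) = app A (app (adj R) \<psi>)"
    and skew: "adj A = - A"
  shows "bracket_HN A R = 0"
proof (rule evv_mono2_nondegenerate)
  show "vhomog 2 (bracket_HN A R)"
    unfolding bracket_HN_def
    by (intro vhomog_diff vhomog_uminus vhomog_add vhomog_tapp vhomog_tlin vhomog_tlin_adj
        vhomog_shadow vhomog_qv vhomog_pv)
next
  fix \<psi>\<^sub>1 \<phi>\<^sub>1 \<psi>\<^sub>2 \<phi>\<^sub>2 :: "'a vfun"
  let ?m = "mono2 (jet \<psi>\<^sub>1 \<phi>\<^sub>1) (jet \<psi>\<^sub>2 \<phi>\<^sub>2)"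
  let ?X = "\<lambda>\<psi> \<phi>. app (lin_op R \<phi>) (app A \<psi>) - app (lin_op A \<psi>) (app R \<phi>)
    + app A (app (adj (lin_op R \<phi>)) \<psi> - app (lin_op (adj R) \<psi>) \<phi>)
    + app R (app (lin_op A \<psi>) \<phi>)"
  have 1: "evv ?m (tlin (shadow_N R) (shadow_H A)) =
      app (lin_op R \<phi>\<^sub>1) (app A \<psi>\<^sub>2) - app (lin_op R \<phi>\<^sub>2) (app A \<psi>\<^sub>1)"
    by (simp add: evv_tlin[OF represents_shadow(2) represents_shadow(2)] vhomog_shadow[simplified] evv_shadow)
  have 2: "evv ?m (tlin (shadow_H A) (shadow_N R)) =
      app (lin_op A \<psi>\<^sub>1) (app R \<phi>\<^sub>2) - app (lin_op A \<psi>\<^sub>2) (app R \<phi>\<^sub>1)"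
    by (simp add: evv_tlin[OF represents_shadow(1) represents_shadow(1)] vhomog_shadow[simplified] evv_shadow)
  have 3: "evv ?m (tlin_adj (shadow_N R) pv) =
      app (adj (lin_op R \<phi>\<^sub>1)) \<psi>\<^sub>2 - app (adj (lin_op R \<phi>\<^sub>2)) \<psi>\<^sub>1"
    by (simp add: evv_tlin_adj[OF represents_shadow(2) represents_shadow(2)] vhomog_shadow[simplified]
        vhomog_pv[simplified] evv_pv)
  have 4: "evv ?m (tlin (tapp (adj R) pv) qv) = app (lin_op (adj R) \<psi>\<^sub>1) \<phi>\<^sub>2 - app (lin_op (adj R) \<psi>\<^sub>2) \<phi>\<^sub>1"
    \<comment> \<open>\<open>tapp (adj R) pv\<close> is the shadow \<open>shadow_H (adj R)\<close>,
      to which \<open>represents_shadow\<close> applies.\<close>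
    unfolding shadow_eq_tapp(1)[symmetric]
    by (simp add: evv_tlin[OF represents_shadow(1) represents_shadow(1)] vhomog_shadow[simplified]
        vhomog_qv[simplified] evv_qv)
  have 5: "evv ?m (tlin (shadow_H A) qv) = app (lin_op A \<psi>\<^sub>1) \<phi>\<^sub>2 - app (lin_op A \<psi>\<^sub>2) \<phi>\<^sub>1"
    by (simp add: evv_tlin[OF represents_shadow(1) represents_shadow(1)] vhomog_shadow[simplified]
        vhomog_qv[simplified] evv_qv)
  have 6: "evv ?m (tapp A (tlin_adj (shadow_N R) pv + tlin (tapp (adj R) pv) qv)) =
      app A (evv ?m (tlin_adj (shadow_N R) pv + tlin (tapp (adj R) pv) qv))"
    by (intro evv_tapp_mono2 vhomog_add vhomog_tapp vhomog_tlin vhomog_tlin_adj vhomog_shadow vhomog_qv vhomog_pv)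
  have 7: "evv ?m (tapp R (tlin (shadow_H A) qv)) = app R (evv ?m (tlin (shadow_H A) qv))"
    by (intro evv_tapp_mono2 vhomog_tlin vhomog_shadow vhomog_qv)
  \<comment> \<open>Every term is of degree one in \<open>p\<close> and one in \<open>q\<close>, so
    the alternation couples the \<open>\<psi>\<close> of one pair with the \<open>\<phi>\<close> of
    the other.\<close>
  have "evv ?m (bracket_HN A R) = ?X \<psi>\<^sub>1 \<phi>\<^sub>2 - ?X \<psi>\<^sub>2 \<phi>\<^sub>1"
    unfolding bracket_HN_def evv_diff evv_uminus evv_add 6 7 1 2 3 4 5 app_diff app_add
    by (simp add: algebra_simps)
  then show "evv ?m (bracket_HN A R) = 0"
    unfolding lin_op_mixed_identity[OF assms] by simp
qed

theorem theorem12: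
  fixes f :: "'m::finite vfun" and A R :: "'m cdo"
  assumes "poisson_nijenhuis f A R"
  shows "bracket_HH A A = 0 \<and> bracket_NN R R = 0 \<and> bracket_HN A R = 0"
  using assms unfolding poisson_nijenhuis_def
  by (auto intro!: bracket_HH_eq_0 bracket_NN_eq_0 bracket_HN_eq_0 simp: hamiltonian_def)

end
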